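(* Let $n\ge1$, $\mathbf{G}_n=\{(x_1,\dots,x_n):0\le x_1\le 2,\ 0\le x_i\le 2x_{i-1}\ (2\le i\le n)\}$. Let $F$ be a plane forest on $n+1$ nodes with $m$ components $T_1,\dots,T_m$ (left to right), $T_j$ having $a_j$ nodes, and let $\mathbf{D}_F=\mathbf{D}_{T_1}\times\operatorname{cone}(\mathbf{D}_{T_2}\times\operatorname{cone}(\mathbf{D}_{T_3}\times\cdots\operatorname{cone}(\mathbf{D}_{T_m})\cdots))\subset\mathbb{R}^n$. Then $\mathbf{D}_F$ is a bounded polytope and $$n!\operatorname{vol}\mathbf{D}_F=\bigl|\{G\text{ labeled graph on }\{1,\dots,n+1\}:\Psi(G)=F\}\bigr|=\frac{\binom{n}{d_1,d_2,\dots}}{\prod_{j=2}^m(a_j+\dots+a_m)}\cdot 2^{\binom{n+2-m}{2}-\sum_{i=1}^{n+1-m} i\,d_i},$$ where $(d_1,\dots,d_{n+1-m})$ is the reduced degree sequence of $F$. Furthermore, the polytopes $\mathbf{D}_F$, $F$ ranging over plane forests on $n+1$ nodes, form a subdivision of $\mathbf{G}_n$; in particular $n!\operatorname{vol}\mathbf{G}_n=2^{\binom{n+1}{2}}$.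
   Context: A plane tree is an unlabeled rooted tree with children of each node ordered left to right; a plane forest is a left-to-right sequence of plane trees. Degree of a node = number of children. The degree sequence of a plane tree on $N$ nodes lists the degrees of the nodes in depth-first (preorder) traversal (root, then subtrees of children recursively left to right); the degree sequence of a forest is the concatenation of those of its components left to right, and the reduced degree sequence is obtained by deleting, for each component, the final $0$ of its degree sequence. $\binom{n}{d_1,d_2,\dots}$ denotes $n!/(d_1!\,d_2!\cdots)$. NFS positions in a forest on $N$ nodes: components processed left to right; when a component is begun its root gets the next unused position (starting from $0$); within a component the root is initially active, the children of the active node receive the next consecutive positions from right to left and then the leftmost child becomes active; if the active node has no children, the most recently positioned node not yet active becomes active. Cane path: a path $v_0,\dots,v_k$ ($k\ge 2$) whose first $k-1$ steps go from a node to its parent and whose last step goes from $v_{k-1}$ to a child of $v_{k-1}$ to the right of $v_{k-2}$. For a plane tree $T$ on $a$ nodes, $\mathbf{D}_T\subset\mathbb{R}^{a-1}$ is defined (with $x_0:=1$, positions $p(u)$ and cane counts $j(u)$ computed in $T$) by $1\le x_{p(u_1)}/2^{j(u_1)}\le\dots\le x_{p(u_k)}/2^{j(u_k)}\le 2$ for every node with children $u_1,\dots,u_k$ left to right. For $\mathbf{P}\subset\mathbb{R}^d$, $\operatorname{cone}(\mathbf{P})=\{(x_0,\dots,x_d):0\le x_0\le1,\ (x_1,\dots,x_d)\in x_0\mathbf{P}\}$ (equal to $[0,1]$ if $d=0$). If $m=1$, $\mathbf{D}_F=\mathbf{D}_{T_1}$. Labeled forests on $\{1,\dots,n+1\}$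 are viewed as plane forests by rooting components at the largest label, ordering children by increasing label and components by decreasing largest label. NFS of a labeled graph $G$ on $\{1,\dots,n+1\}$: components are processed in order of decreasing maximal label; in a component, its node of maximal label is visited first and made active; at each step the unvisited neighbours of the active node are visited in decreasing order of label, each joined to the active node by a search edge, and the one of smallest label becomes active; if the active node has no unvisited neighbours, the most recently visited node not yet active becomes active. $\Psi(G)$ is the plane forest underlying the labeled forest of search edges. A subdivision of a polytope $P$ is a finite set of full-dimensional polytopes with union $P$ and pairwise disjoint interiors. *)

theory Defs
  imports "HOL-Analysis.Analysis"
begin

section \<open>Plane trees and plane forests\<close>

datatype plane_tree = PNode (subtrees: "plane_tree list")

type_synonym plane_forest = "plane_tree list"

fun num_nodes :: "plane_tree \<Rightarrow> nat" where
  "num_nodes (PNode ts) = Suc (\<Sum>t\<leftarrow>ts. num_nodes t)"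

definition plane_forests :: "nat \<Rightarrow> plane_forest set" where
  "plane_forests N = {F. (\<Sum>t\<leftarrow>F. num_nodes t) = N}"

fun degree_seq :: "plane_tree \<Rightarrow> nat list" where
  "degree_seq (PNode ts) = length ts # concat (map degree_seq ts)"

definition reduced_degree_seq :: "plane_forest \<Rightarrow> nat list" where
  "reduced_degree_seq F = concat (map (\<lambda>t. butlast (degree_seq t)) F)"

text \<open>
  A node is identified with the path from the root to it: \<open>[]\<close> is the root, and \<open>v @ [i]\<close> is
  the \<open>i\<close>-th child of \<open>v\<close>, counting from the left and from \<open>0\<close>.
\<close>

type_synonym node = "nat list"

fun is_node :: "plane_tree \<Rightarrow> node \<Rightarrow> bool" where
  "is_node t [] = True"
| "is_node (PNode ts) (i # v) = (i < length ts \<and> is_node (ts ! i) v)"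

definition nodes :: "plane_tree \<Rightarrow> node set" where
  "nodes t = {v. is_node t v}"

fun subtree_at :: "plane_tree \<Rightarrow> node \<Rightarrow> plane_tree" where
  "subtree_at t [] = t"
| "subtree_at (PNode ts) (i # v) = subtree_at (ts ! i) v"

definition children :: "plane_tree \<Rightarrow> node \<Rightarrow> node list" where
  "children t v = map (\<lambda>i. v @ [i]) [0..<length (subtrees (subtree_at t v))]"


section \<open>NFS positions and cane paths in a plane tree\<close>

text \<open>
  The argument of \<open>nfs_from\<close> lists the nodes (with their subtrees) that have a position but have
  not been active yet, the most recently positioned one first; its head becomes active next.
  The children of the active node are positioned from right to left, so the leftmost child is
  the most recently positioned node.  Hence both rules for choosing the next active node say:
  take the head of the list.  The result lists the nodes positioned from then on, in the order
  of their positions.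
\<close>

function nfs_from :: "(node \<times> plane_tree) list \<Rightarrow> node list" where
  "nfs_from [] = []"
| "nfs_from ((v, PNode ts) # st) =
     (let cs = map (\<lambda>i. (v @ [i], ts ! i)) [0..<length ts]
      in map fst (rev cs) @ nfs_from (cs @ st))"
  by pat_completeness auto
termination
proof (relation "Wellfounded.measure (\<lambda>st. \<Sum>(v, t)\<leftarrow>st. num_nodes t)")
  fix v ts and st cs :: "(node \<times> plane_tree) list"
  assume "cs = map (\<lambda>i. (v @ [i], ts ! i)) [0..<length ts]"
  then have "map (\<lambda>(v, t). num_nodes t) cs = map num_nodes (map (\<lambda>i. ts ! i) [0..<length ts])"
    by simp
  then have "map (\<lambda>(v, t). num_nodes t) cs = map num_nodes ts"
    by (simp only: map_nth)
  then show "(cs @ st, (v, PNode ts) # st) \<in> Wellfounded.measure (\<lambda>st. \<Sum>(v, t)\<leftarrow>st. num_nodes t)"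
    by simp
qed simp

definition nfs_order :: "plane_tree \<Rightarrow> node list" where
  "nfs_order t = [] # nfs_from [([], t)]"

definition nfs_position :: "plane_tree \<Rightarrow> node \<Rightarrow> nat" where
  "nfs_position t v = (THE i. i < length (nfs_order t) \<and> nfs_order t ! i = v)"

text \<open>
  A cane path \<open>v\<^sub>0, \<dots>, v\<^sub>k\<close> is given by the list of its nodes, and \<open>k\<close> is the length of the list
  minus \<open>1\<close>.
\<close>

definition cane_path :: "plane_tree \<Rightarrow> node list \<Rightarrow> bool" where
  "cane_path t vs \<longleftrightarrow> set vs \<subseteq> nodes t \<and>
     (\<exists>k\<ge>2. length vs = k + 1 \<and>
       (\<forall>i<k-1. \<exists>c. vs ! i = vs ! (i+1) @ [c]) \<and>
       (\<exists>c c'. vs ! (k-2) = vs ! (k-1) @ [c] \<and> vs ! k = vs ! (k-1) @ [c'] \<and> c < c'))"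

definition cane_count :: "plane_tree \<Rightarrow> node \<Rightarrow> nat" where
  "cane_count t u = card {vs. cane_path t vs \<and> hd vs = u}"


section \<open>The polytopes\<close>

text \<open>
  Since the dimension changes in the recursive construction, points of \<open>\<real>\<^sup>d\<close> are first
  represented by lists of length \<open>d\<close>.
\<close>

definition node_coord :: "plane_tree \<Rightarrow> real list \<Rightarrow> node \<Rightarrow> real" where
  "node_coord t xs u = (1 # xs) ! nfs_position t u / 2 ^ cane_count t u"

definition D_tree :: "plane_tree \<Rightarrow> real list set" where
  "D_tree t = {xs. length xs = num_nodes t - 1 \<and>
     (\<forall>v\<in>nodes t. sorted ([1] @ map (node_coord t xs) (children t v) @ [2]))}"

definition cone_over :: "real list set \<Rightarrow> real list set" where
  "cone_over P = {x0 # map (\<lambda>y. x0 * y) ys | x0 ys. 0 \<le> x0 \<and> x0 \<le> 1 \<and> ys \<in> P}"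

text \<open>The value for the empty forest is a dummy.\<close>

fun D_list :: "plane_forest \<Rightarrow> real list set" where
  "D_list [] = {[]}"
| "D_list [t] = D_tree t"
| "D_list (t # t' # F) = {xs @ ys | xs ys. xs \<in> D_tree t \<and> ys \<in> cone_over (D_list (t' # F))}"

text \<open>
  The space \<open>\<real>\<^sup>n\<close> is \<^typ>\<open>real ^ 'n\<close> with \<open>CARD('n) = n\<close>.  The bijection \<open>e\<close> from
  \<open>{1..n}\<close> to \<^typ>\<open>'n\<close> numbers the coordinates: \<open>x\<^sub>i\<close> is \<open>x $ e i\<close>.
\<close>

definition coord_list :: "(nat \<Rightarrow> 'n::finite) \<Rightarrow> real ^ 'n \<Rightarrow> real list" where
  "coord_list e x = map (\<lambda>i. x $ e i) [1..<CARD('n) + 1]"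

definition D_forest :: "(nat \<Rightarrow> 'n::finite) \<Rightarrow> plane_forest \<Rightarrow> (real ^ 'n) set" where
  "D_forest e F = {x. coord_list e x \<in> D_list F}"

definition Gayley :: "(nat \<Rightarrow> 'n::finite) \<Rightarrow> (real ^ 'n) set" where
  "Gayley e = {x. 0 \<le> x $ e 1 \<and> x $ e 1 \<le> 2 \<and>
     (\<forall>i\<in>{2..CARD('n)}. 0 \<le> x $ e i \<and> x $ e i \<le> 2 * x $ e (i - 1))}"

definition subdivision :: "'a::euclidean_space set set \<Rightarrow> 'a set \<Rightarrow> bool" where
  "subdivision \<S> P \<longleftrightarrow> polytope P \<and> finite \<S> \<and>
     (\<forall>S\<in>\<S>. polytope S \<and> aff_dim S = int DIM('a)) \<and>
     \<Union>\<S> = P \<and>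
     (\<forall>S\<in>\<S>. \<forall>S'\<in>\<S>. S \<noteq> S' \<longrightarrow> interior S \<inter> interior S' = {})"


section \<open>Labeled graphs and the map to plane forests\<close>

text \<open>A simple graph on \<open>{1..N}\<close> is given by its set of edges.\<close>

definition labeled_graphs :: "nat \<Rightarrow> nat set set set" where
  "labeled_graphs N = Pow {a. a \<subseteq> {1..N} \<and> card a = 2}"

text \<open>
  In \<open>search_edges E us st\<close>, the list \<open>us\<close> contains the unvisited nodes in decreasing order, and
  \<open>st\<close> the visited nodes that have not been active yet, the most recently visited one first.
  As for plane trees, the node that becomes active next is always the head of \<open>st\<close>: the unvisited
  neighbours of the active node are visited in decreasing order, so the smallest of them is the
  most recently visited node.  If \<open>st\<close> is empty, the current component is exhausted, and the
  largest unvisited node is the maximal node of the next component.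
\<close>

function search_edges :: "nat set set \<Rightarrow> nat list \<Rightarrow> nat list \<Rightarrow> nat set set" where
  "search_edges E [] [] = {}"
| "search_edges E (u # us) [] = search_edges E us [u]"
| "search_edges E us (v # st) =
     (let nbs = filter (\<lambda>u. {v, u} \<in> E) us
      in (\<lambda>u. {v, u}) ` set nbs \<union>
         search_edges E (filter (\<lambda>u. {v, u} \<notin> E) us) (rev nbs @ st))"
  by pat_completeness auto
termination
proof (relation "Wellfounded.measure (\<lambda>(E, us, st). 2 * length us + length st)")
  fix E :: "nat set set" and us nbs st :: "nat list" and v :: nat
  assume "nbs = filter (\<lambda>u. {v, u} \<in> E) us"
  then have "length nbs + length (filter (\<lambda>u. {v, u} \<notin> E) us) = length us"
    by (simp add: sum_length_filter_compl)
  then show "((E, filter (\<lambda>u. {v, u} \<notin> E) us, rev nbs @ st), (E, us, v # st))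
      \<in> Wellfounded.measure (\<lambda>(E, us, st). 2 * length us + length st)"
    by simp
qed simp_all

definition nfs_forest :: "nat \<Rightarrow> nat set set \<Rightarrow> nat set set" where
  "nfs_forest N E = search_edges E (rev [1..<N+1]) []"

text \<open>
  For a forest with edge set \<open>S\<close>, \<open>plane_tree_at S W v\<close> is the plane tree rooted at \<open>v\<close> and
  spanned by the nodes that can be reached from \<open>v\<close> inside \<open>W\<close>.  Removing \<open>v\<close> from \<open>W\<close> prevents
  the recursion from returning from a child to its parent.
\<close>

function plane_tree_at :: "nat set set \<Rightarrow> nat set \<Rightarrow> nat \<Rightarrow> plane_tree" where
  "plane_tree_at S W v =
     (if finite W \<and> v \<in> W
      then PNode (map (plane_tree_at S (W - {v})) (sorted_list_of_set {u \<in> W - {v}. {v, u} \<in> S}))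
      else PNode [])"
  by pat_completeness auto
termination
  by (relation "Wellfounded.measure (\<lambda>(S, W, v). card W)") (auto simp: card_gt_0_iff intro!: diff_less)

declare plane_tree_at.simps [simp del]

definition component_roots :: "nat \<Rightarrow> nat set set \<Rightarrow> nat set" where
  "component_roots N S =
     {v \<in> {1..N}. \<forall>u\<in>{1..N}. (v, u) \<in> {(a, b). {a, b} \<in> S}\<^sup>* \<longrightarrow> u \<le> v}"

definition underlying_plane_forest :: "nat \<Rightarrow> nat set set \<Rightarrow> plane_forest" where
  "underlying_plane_forest N S =
     map (plane_tree_at S {1..N}) (rev (sorted_list_of_set (component_roots N S)))"

definition Psi :: "nat \<Rightarrow> nat set set \<Rightarrow> plane_forest" where
  "Psi N E = underlying_plane_forest N (nfs_forest N E)"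

definition multinomial_coeff :: "nat \<Rightarrow> nat list \<Rightarrow> real" where
  "multinomial_coeff n ds = fact n / (\<Prod>d\<leftarrow>ds. fact d)"

end

theory Submission
  imports Defs
begin

text \<open>
  When NFS on a plane tree activates a node, its cane count equals the number of positioned nodes
  that have not been active yet.  Hence a point of \<open>D_F\<close> can be read off coordinate by coordinate:
  if \<open>c\<close> nodes wait on the stack and \<open>s\<close> is the coordinate of the root of the current component,
  then the next coordinate is either at least \<open>2\<^sup>c s\<close> and belongs to a further child of the active
  node, or at most \<open>2\<^sup>c s\<close> and belongs to a later node, so that the stack is popped (for \<open>c = 0\<close> a
  new component begins).  Reading all points of the Gayley polytope in this way gives the subdivision.
  The same machine, run on labeled graphs, chooses at each step the unvisited neighbours of the
  active node freely, and likewise its edges to the waiting nodes.  The iterated integral and the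
  count of graphs therefore satisfy the same recursion, up to the factor
  \<open>fact r * 2 ^ (length st choose 2)\<close> with \<open>r\<close> unvisited nodes.
\<close>

subsection \<open>Reading a point coordinate by coordinate\<close>

text \<open>Along the stack the cane counts are \<open>0, 1, 2, ...\<close> from bottom to top, so
  the powers of two in the inequalities at the active node depend on the stack height alone. Read
  from right to left, its children have cane counts \<open>c, c + 1, ...\<close>; each coordinate is
  therefore at most twice the preceding one, and a pop never raises the bound. This is how the
  inequalities of the Gayley polytope arise. The cones are the reason for the parameter
  \<open>s\<close>: every inequality is homogeneous, so the slice of a cone at height
  \<open>s\<close> is again a cell, with the new root at \<open>s\<close> in place of
  \<open>1\<close>. Ties with a threshold are the only ambiguity of the reading, and they lie in
  countably many hyperplanes. In the factor, \<open>fact r\<close> absorbs the binomial coefficients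
  from the choices of unvisited neighbours, and \<open>2 ^ (length st choose 2)\<close> counts the
  sets of edges among the waiting nodes, which the search never inspects.\<close>

abbreviation total_nodes :: "plane_tree list \<Rightarrow> nat" where
  "total_nodes ts \<equiv> (\<Sum>t\<leftarrow>ts. num_nodes t)"

text \<open>
  \<open>cell rs st F s u xs\<close> reads the coordinates \<open>xs\<close> one at a time: \<open>rs\<close> are the subtrees at the
  unpositioned children of the active node, from right to left, \<open>st\<close> those at the positioned nodes
  that have not been active yet, \<open>F\<close> the components not yet begun, \<open>s\<close> the coordinate of the root
  of the current component, and \<open>u\<close> the upper bound of the next coordinate.  The cane count of the
  next child is \<open>length st\<close>.
\<close>

function cell :: "plane_tree list \<Rightarrow> plane_tree list \<Rightarrow> plane_forest \<Rightarrow> real \<Rightarrow> real \<Rightarrow> real list \<Rightarrow> bool" where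
  "cell [] [] [] s u xs \<longleftrightarrow> xs = []"
| "cell [] [] (PNode ts # F) s u [] \<longleftrightarrow> False"
| "cell [] [] (PNode ts # F) s u (x # xs) \<longleftrightarrow> 0 \<le> x \<and> x \<le> s \<and> cell (rev ts) [] F x (2 * x) xs"
| "cell [] (PNode ts # st) F s u xs \<longleftrightarrow> cell (rev ts) st F s (2 ^ Suc (length st) * s) xs"
| "cell (t # rs) st F s u [] \<longleftrightarrow> False"
| "cell (t # rs) st F s u (x # xs) \<longleftrightarrow>
     2 ^ length st * s \<le> x \<and> x \<le> u \<and> cell rs (t # st) F s (2 * x) xs"
  by pat_completeness auto

lemma num_nodes_pos: "0 < num_nodes t"
  by (cases t) simp

termination
\<comment> \<open>A waiting node weighs one less than an unpositioned one, so both a push and a pop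
  lower the measure. The same weight drives later inductions on cells.\<close>
proof (relation "Wellfounded.measure
    (\<lambda>(rs, st, F, _). 2 * total_nodes rs + (\<Sum>t\<leftarrow>st. 2 * num_nodes t - 1) + 2 * total_nodes F)")
  fix t :: plane_tree and rs st F and s u x :: real and xs
  show "((rs, t # st, F, s, 2 * x, xs), (t # rs, st, F, s, u, x # xs)) \<in> Wellfounded.measure
      (\<lambda>(rs, st, F, _). 2 * total_nodes rs + (\<Sum>t\<leftarrow>st. 2 * num_nodes t - 1) + 2 * total_nodes F)"
    using num_nodes_pos[of t] by simp
qed (simp_all add: sum_list_rev flip: rev_map)

lemma cell_empty_stack:
  "cell [] [] (PNode ts # F) s u xs \<longleftrightarrow>
     (\<exists>x ys. xs = x # ys \<and> 0 \<le> x \<and> x \<le> s \<and> cell (rev ts) [] F x (2 * x) ys)"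
  by (cases xs) auto

lemma cell_Cons:
  "cell (t # rs) st F s u xs \<longleftrightarrow>
     (\<exists>x ys. xs = x # ys \<and> 2 ^ length st * s \<le> x \<and> x \<le> u \<and> cell rs (t # st) F s (2 * x) ys)"
  by (cases xs) auto

text \<open>The bound concerns only further children of the active node; popping the stack or
  starting a component sets a new one. Hence the free variables \<open>u\<close> and
  \<open>v\<close> in later statements.\<close>

lemma cell_bound_irrelevant: "cell [] st F s u xs \<longleftrightarrow> cell [] st F s u' xs"
proof (cases st)
  case Nil
  then show ?thesis
    by (cases F; cases "hd F"; cases xs) auto
next
  case (Cons t st')
  then show ?thesis
    by (cases t) auto
qed

text \<open>Each coordinate positions one node, and the nodes on the stack are positioned
  already.\<close>

lemma cell_total_nodes:
  "cell rs st F s u xs \<Longrightarrow> total_nodes rs + total_nodes st + total_nodes F = length xs + length st"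
  by (induction rs st F s u xs rule: cell.induct) (auto simp: sum_list_rev simp flip: rev_map)

text \<open>The inequalities within one family of children, read from the right: each push doubles
  the threshold, and each coordinate is at most twice the one before. With \<open>l = 0\<close> and
  \<open>u = 2\<close> the same predicate describes the Gayley polytope.\<close>

fun chain :: "real \<Rightarrow> real \<Rightarrow> real list \<Rightarrow> bool" where
  "chain l u [] \<longleftrightarrow> True"
| "chain l u (y # ys) \<longleftrightarrow> l \<le> y \<and> y \<le> u \<and> chain (2 * l) (2 * y) ys"

text \<open>Reads a whole family at once: pushing from right to left leaves the leftmost child on
  top, hence \<open>rev rs\<close>.\<close>

lemma cell_children:
  "cell rs st F s u xs \<longleftrightarrow>
     (\<exists>ys zs. xs = ys @ zs \<and> length ys = length rs \<and> chain (2 ^ length st * s) u ys \<and>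
        cell [] (rev rs @ st) F s v zs)"
proof (induction rs arbitrary: st u xs)
  case Nil
  then show ?case
    using cell_bound_irrelevant by auto
next
  case (Cons t rs)
  show ?case
  proof
    assume "cell (t # rs) st F s u xs"
    then obtain x xs' where xs: "xs = x # xs'" "2 ^ length st * s \<le> x" "x \<le> u"
      "cell rs (t # st) F s (2 * x) xs'"
      by (auto simp: cell_Cons)
    then obtain ys zs where "xs' = ys @ zs" "length ys = length rs"
      "chain (2 ^ Suc (length st) * s) (2 * x) ys" "cell [] (rev rs @ t # st) F s v zs"
      using Cons.IH[of "t # st" "2 * x" xs'] by auto
    with xs show "\<exists>ys zs. xs = ys @ zs \<and> length ys = length (t # rs) \<and>
        chain (2 ^ length st * s) u ys \<and> cell [] (rev (t # rs) @ st) F s v zs"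
      by (intro exI[of _ "x # ys"] exI[of _ zs]) (auto simp: mult.assoc)
  next
    assume "\<exists>ys zs. xs = ys @ zs \<and> length ys = length (t # rs) \<and>
        chain (2 ^ length st * s) u ys \<and> cell [] (rev (t # rs) @ st) F s v zs"
    then obtain x ys zs where "xs = x # ys @ zs" "length ys = length rs"
      "2 ^ length st * s \<le> x" "x \<le> u"
      "chain (2 ^ Suc (length st) * s) (2 * x) ys" "cell [] (rev rs @ t # st) F s v zs"
      by (auto simp: length_Suc_conv mult.assoc)
    then show "cell (t # rs) st F s u xs"
      using Cons.IH[of "t # st" "2 * x" "ys @ zs"] by auto
  qed
qed

lemma cell_children_append:
  assumes "length ys = length rs"
  shows "cell rs st F s u (ys @ zs) \<longleftrightarrow>
    chain (2 ^ length st * s) u ys \<and> cell [] (rev rs @ st) F s v zs"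
proof
  assume "cell rs st F s u (ys @ zs)"
  then show "chain (2 ^ length st * s) u ys \<and> cell [] (rev rs @ st) F s v zs"
    using assms by (subst (asm) cell_children[where v = v]) (metis append_eq_append_conv)
next
  assume "chain (2 ^ length st * s) u ys \<and> cell [] (rev rs @ st) F s v zs"
  with assms show "cell rs st F s u (ys @ zs)"
    by (subst cell_children[where v = v]) blast
qed

text \<open>\<open>F\<close> is consulted only when the stack is empty, and \<open>s\<close> does
  not change before that, so the coordinates of the current component can be cut off. This produces
  the product in \<open>D_list\<close>.\<close>

lemma cell_split_component:
  "cell rs st F s u xs \<longleftrightarrow>
     (\<exists>ys zs. xs = ys @ zs \<and> cell rs st [] s u ys \<and> cell [] [] F s v zs)"
proof (induction "2 * total_nodes rs + (\<Sum>t\<leftarrow>st. 2 * num_nodes t - 1)" arbitrary: rs st u xs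
    rule: less_induct)
  case less
  show ?case
  proof (cases rs)
    case (Cons t rs')
    have "2 * total_nodes rs' + (\<Sum>t\<leftarrow>t # st. 2 * num_nodes t - 1)
        < 2 * total_nodes rs + (\<Sum>t\<leftarrow>st. 2 * num_nodes t - 1)"
      using Cons num_nodes_pos[of t] by simp
    from less[OF this] show ?thesis
      unfolding Cons cell_Cons by (auto 4 4 intro: exI[of _ "_ # _"])
  next
    case Nil
    show ?thesis
    proof (cases st)
      case st: Nil
      then show ?thesis
        using Nil cell_bound_irrelevant[of "[]" F s u xs v] by auto
    next
      case (Cons t st')
      obtain ts where t: "t = PNode ts"
        by (cases t)
      have "2 * total_nodes (rev ts) + (\<Sum>t\<leftarrow>st'. 2 * num_nodes t - 1)
          < 2 * total_nodes rs + (\<Sum>t\<leftarrow>st. 2 * num_nodes t - 1)"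
        using Cons Nil t by (simp add: sum_list_rev flip: rev_map)
      from less[OF this] show ?thesis
        by (simp add: Nil Cons t)
    qed
  qed
qed

lemma cell_scale:
  assumes "0 < a"
  shows "cell rs st F (a * s) (a * u) (map ((*) a) xs) \<longleftrightarrow> cell rs st F s u xs"
  using assms
proof (induction rs st F s u xs rule: cell.induct)
  case (4 ts st F s u xs)
  then show ?case
    by (simp add: mult.left_commute)
next
  case (6 t rs st F s u x xs)
  have "2 ^ length st * (a * s) \<le> a * x \<longleftrightarrow> 2 ^ length st * s \<le> x"
    using 6 by (metis mult.left_commute mult_le_cancel_left_pos)
  with 6 show ?case
    by (simp add: mult.left_commute)
qed (auto simp: mult.left_commute zero_le_mult_iff)

text \<open>Invariant: the threshold is at most the bound. A push keeps it because the coordinate is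
  at least the old threshold; a pop replaces the bound by the current threshold, which can only
  tighten it.\<close>

lemma cell_nonneg:
  "cell rs st F s u xs \<Longrightarrow> 0 \<le> s \<Longrightarrow> 2 ^ length st * s \<le> u \<Longrightarrow> chain 0 u xs"
proof (induction rs st F s u xs rule: cell.induct)
  case (3 ts F s u x xs)
  then show ?case by (auto simp: algebra_simps)
next
  case (4 ts st F s u xs)
  have *: "chain 0 u xs \<Longrightarrow> u \<le> v \<Longrightarrow> chain 0 v xs" for u v and xs :: "real list"
    by (cases xs) auto
  from 4 show ?case
    by (auto intro!: *[of "2 ^ Suc (length st) * s" xs u])
next
  case (6 t rs st F s u x xs)
  moreover from this have "0 \<le> x"
    by (smt (verit) cell.simps(6) mult_nonneg_nonneg zero_le_power)
  ultimately show ?case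
    by (auto simp: algebra_simps)
qed auto

lemma chain_zero: "chain 0 0 xs \<longleftrightarrow> (\<forall>x\<in>set xs. x = 0)"
  by (induction xs) auto

text \<open>Every coordinate can be put on its threshold, and every new root at the scale of the
  component before. Nonemptiness makes the apex belong to the cone over a cell.\<close>

lemma cell_nonempty:
  "0 \<le> s \<Longrightarrow> 2 ^ length st * s \<le> u \<Longrightarrow> \<exists>xs. cell rs st F s u xs"
proof (induction "2 * total_nodes rs + (\<Sum>t\<leftarrow>st. 2 * num_nodes t - 1) + 2 * total_nodes F"
    arbitrary: rs st F s u rule: less_induct)
  case less
  show ?case
  proof (cases rs)
    case (Cons t rs')
    have "2 * total_nodes rs' + (\<Sum>t\<leftarrow>t # st. 2 * num_nodes t - 1) + 2 * total_nodes F
        < 2 * total_nodes rs + (\<Sum>t\<leftarrow>st. 2 * num_nodes t - 1) + 2 * total_nodes F"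
      using Cons num_nodes_pos[of t] by simp
    from less(1)[OF this, of s "2 * (2 ^ length st * s)"] less(2,3) show ?thesis
      unfolding Cons cell_Cons by (auto intro: exI[of _ "_ # _"])
  next
    case rs: Nil
    show ?thesis
    proof (cases st)
      case (Cons t st')
      obtain ts where t: "t = PNode ts"
        by (cases t)
      have "2 * total_nodes (rev ts) + (\<Sum>t\<leftarrow>st'. 2 * num_nodes t - 1) + 2 * total_nodes F
          < 2 * total_nodes rs + (\<Sum>t\<leftarrow>st. 2 * num_nodes t - 1) + 2 * total_nodes F"
        using Cons rs t by (simp add: sum_list_rev flip: rev_map)
      from less(1)[OF this, of s "2 ^ Suc (length st') * s"] less(2) show ?thesis
        by (auto simp: rs Cons t)
    next
      case st: Nil
      show ?thesis
      proof (cases F)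
        case (Cons t F')
        obtain ts where t: "t = PNode ts"
          by (cases t)
        have "2 * total_nodes (rev ts) + (\<Sum>t\<leftarrow>[]. 2 * num_nodes t - 1) + 2 * total_nodes F'
            < 2 * total_nodes rs + (\<Sum>t\<leftarrow>st. 2 * num_nodes t - 1) + 2 * total_nodes F"
          using Cons rs t st by (simp add: sum_list_rev flip: rev_map)
        from less(1)[OF this, of s "2 * s"] less(2) obtain xs where "cell (rev ts) [] F' s (2 * s) xs"
          by auto
        with less(2) have "cell rs st F s u (s # xs)"
          by (simp add: rs Cons t st)
        then show ?thesis ..
      qed (auto simp: rs st intro: exI[of _ "[]"])
    qed
  qed
qed

text \<open>The active node has no further children, so the bound may be taken to be
  \<open>0\<close>; scale and bound \<open>0\<close> squeeze the cell to the origin.\<close>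

lemma cell_zero_scale:
  "cell [] [t] F 0 u xs \<longleftrightarrow> length xs + 1 = total_nodes (t # F) \<and> (\<forall>x\<in>set xs. x = 0)"
proof
  assume *: "cell [] [t] F 0 u xs"
  then have "cell [] [t] F 0 0 xs"
    using cell_bound_irrelevant by blast
  with cell_total_nodes[OF *] show "length xs + 1 = total_nodes (t # F) \<and> (\<forall>x\<in>set xs. x = 0)"
    by (auto dest!: cell_nonneg simp: chain_zero)
next
  assume xs: "length xs + 1 = total_nodes (t # F) \<and> (\<forall>x\<in>set xs. x = 0)"
  obtain ys where ys: "cell [] [t] F 0 0 ys"
    using cell_nonempty[of 0 "[t]" 0 "[]" F] by auto
  then have "\<forall>x\<in>set ys. x = 0"
    by (auto dest!: cell_nonneg simp: chain_zero)
  moreover have "length ys = length xs"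
    using xs cell_total_nodes[OF ys] by simp
  ultimately have "ys = xs"
    using xs by (metis replicate_eqI)
  with ys show "cell [] [t] F 0 u xs"
    using cell_bound_irrelevant by blast
qed

text \<open>At height \<open>x > 0\<close> the slice of the cone is the cell rescaled by
  \<open>x\<close>. At height \<open>0\<close> rescaling is not invertible, and both sides are the
  origin.\<close>

lemma cone_over_cell:
  "cone_over {xs. cell [] [t] F 1 u xs} = {xs. cell [] [] (t # F) 1 v xs}"
proof -
  obtain ts where t: "t = PNode ts"
    by (cases t)
  have *: "xs \<in> (\<lambda>ys. map ((*) x) ys) ` {ys. cell [] [t] F 1 u ys} \<longleftrightarrow> cell [] [t] F x u xs"
    if "0 \<le> x" for x xs
  proof (cases "x = 0")
    case True
    show ?thesis
    proof
      assume "xs \<in> (\<lambda>ys. map ((*) x) ys) ` {ys. cell [] [t] F 1 u ys}"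
      then show "cell [] [t] F x u xs"
        using True cell_total_nodes[of "[]" "[t]" F 1 u] by (auto simp: cell_zero_scale)
    next
      assume xs: "cell [] [t] F x u xs"
      obtain ys where ys: "cell [] [t] F 1 u ys"
        using cell_nonempty[of 1 "[t]" 2 "[]" F] cell_bound_irrelevant[of "[t]" F 1 2 _ u] by auto
      have "xs = map ((*) x) ys"
        using True xs cell_total_nodes[OF ys]
        by (auto simp: cell_zero_scale list_eq_iff_nth_eq)
      with ys show "xs \<in> (\<lambda>ys. map ((*) x) ys) ` {ys. cell [] [t] F 1 u ys}"
        by auto
    qed
  next
    case False
    with that have x: "0 < x"
      by simp
    show ?thesis
    proof
      assume "xs \<in> (\<lambda>ys. map ((*) x) ys) ` {ys. cell [] [t] F 1 u ys}"
      then show "cell [] [t] F x u xs"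
        using cell_scale[OF x, of "[]" "[t]" F 1 u] cell_bound_irrelevant[of "[t]" F x "x * u" _ u]
        by auto
    next
      assume xs: "cell [] [t] F x u xs"
      have "xs = map ((*) x) (map ((*) (1 / x)) xs)"
        using x by (simp add: o_def)
      moreover have "cell [] [t] F 1 u (map ((*) (1 / x)) xs)"
        using xs cell_scale[of "1 / x" "[]" "[t]" F x u xs] x
          cell_bound_irrelevant[of "[t]" F 1 "1 / x * u" _ u] by auto
      ultimately show "xs \<in> (\<lambda>ys. map ((*) x) ys) ` {ys. cell [] [t] F 1 u ys}"
        by blast
    qed
  qed
  have "cone_over {xs. cell [] [t] F 1 u xs} =
      {x # xs | x xs. 0 \<le> x \<and> x \<le> 1 \<and> xs \<in> (\<lambda>ys. map ((*) x) ys) ` {ys. cell [] [t] F 1 u ys}}"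
    unfolding cone_over_def by blast
  also have "\<dots> = {x # xs | x xs. 0 \<le> x \<and> x \<le> 1 \<and> cell [] [t] F x u xs}"
    using * by blast
  also have "\<dots> = {xs. cell [] [] (t # F) 1 v xs}"
    by (auto simp: t cell_empty_stack)
  finally show ?thesis .
qed

subsection \<open>The polytopes as cells\<close>

text \<open>Counted from the right, cane counts grow by one, and dividing entry \<open>i\<close> by
  \<open>2 ^ i\<close> turns the doubling bounds into monotonicity. In the induction, halving the
  tail absorbs the doubled bounds; the case \<open>l \<le> y\<close> is split off because the
  induction hypothesis asks for it, and otherwise both sides fail.\<close>

lemma chain_iff_sorted:
  assumes "l \<le> u"
  shows "chain l u ys \<longleftrightarrow> sorted ([l] @ rev (map (\<lambda>i. ys ! i / 2 ^ i) [0..<length ys]) @ [u])"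
  using assms
proof (induction ys arbitrary: l u)
  case (Cons y ys)
  have map: "map (\<lambda>i. (y # ys) ! i / 2 ^ i) [0..<length (y # ys)] =
      y # map (\<lambda>a. a / 2) (map (\<lambda>i. ys ! i / 2 ^ i) [0..<length ys])"
    unfolding length_Cons upt_conv_Cons[OF zero_less_Suc] map_Suc_upt[symmetric] by simp
  have half: "sorted (map (\<lambda>a. a / 2) zs) \<longleftrightarrow> sorted zs" for zs :: "real list"
    by (simp add: sorted_map)
  let ?A = "rev (map (\<lambda>i. ys ! i / 2 ^ i) [0..<length ys])"
  show ?case
  proof (cases "l \<le> y")
    case True
    have "chain (2 * l) (2 * y) ys \<longleftrightarrow> sorted ([2 * l] @ ?A @ [2 * y])"
      using Cons.IH[of "2 * l" "2 * y"] True by simp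
    also have "\<dots> \<longleftrightarrow> sorted (map (\<lambda>a. a / 2) ([2 * l] @ ?A @ [2 * y]))"
      by (rule half[symmetric])
    also have "\<dots> \<longleftrightarrow> sorted ([l] @ map (\<lambda>a. a / 2) ?A @ [y])"
      by simp
    finally have *: "chain (2 * l) (2 * y) ys \<longleftrightarrow> sorted ([l] @ map (\<lambda>a. a / 2) ?A @ [y])" .
    have snoc: "sorted (zs @ [y, u]) \<longleftrightarrow> y \<le> u \<and> sorted (zs @ [y])" for zs
      by (induction zs) auto
    show ?thesis
      unfolding map using True * snoc[of "l # map (\<lambda>a. a / 2) ?A"]
      by (simp add: rev_map[symmetric])
  next
    case False
    then show ?thesis
      unfolding map by (simp add: sorted_append)
  qed
qed simp

section \<open>Nodes of a plane tree and their NFS order\<close>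

lemma nodes_PNode: "nodes (PNode ts) = insert [] (\<Union>i<length ts. (#) i ` nodes (ts ! i))"
proof (intro set_eqI)
  fix v
  show "v \<in> nodes (PNode ts) \<longleftrightarrow> v \<in> insert [] (\<Union>i<length ts. (#) i ` nodes (ts ! i))"
    by (cases v) (auto simp: nodes_def)
qed

lemma card_nodes: "finite (nodes t) \<and> card (nodes t) = num_nodes t"
proof (induction t)
  case (PNode ts)
  then have IH: "finite (nodes (ts ! i)) \<and> card (nodes (ts ! i)) = num_nodes (ts ! i)"
    if "i < length ts" for i
    using that by simp
  have "card (\<Union>i<length ts. (#) i ` nodes (ts ! i)) = (\<Sum>i<length ts. num_nodes (ts ! i))"
    by (subst card_UN_disjoint) (auto simp: IH card_image intro!: sum.cong)
  also have "\<dots> = total_nodes ts"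
    by (simp add: sum_list_sum_nth lessThan_atLeast0)
  finally show ?case
    using IH by (auto simp: nodes_PNode card_insert_if)
qed

lemma length_nfs_from: "length (nfs_from stk) + length stk = (\<Sum>(v, t)\<leftarrow>stk. num_nodes t)"
proof (induction stk rule: nfs_from.induct)
  case (2 v ts st)
  let ?cs = "map (\<lambda>i. (v @ [i], ts ! i)) [0..<length ts]"
  have "(\<Sum>(v, t)\<leftarrow>?cs. num_nodes t) = total_nodes ts"
    by (simp add: o_def map_nth flip: map_map[of num_nodes "\<lambda>i. ts ! i", unfolded o_def])
  with 2[OF refl] show ?case
    by (simp add: Let_def)
qed simp

lemma root_in_nodes: "[] \<in> nodes t"
  by (simp add: nodes_def)

text \<open>A stack entry has its own position already, so it contributes exactly its proper
  descendants.\<close>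

lemma set_nfs_from:
  "set (nfs_from stk) = (\<Union>(v, t)\<in>set stk. (@) v ` (nodes t - {[]}))"
proof (induction stk rule: nfs_from.induct)
  case (2 v ts st)
  let ?cs = "map (\<lambda>i. (v @ [i], ts ! i)) [0..<length ts]"
  have "(@) v ` (nodes (PNode ts) - {[]}) =
      (\<Union>i<length ts. insert (v @ [i]) ((@) (v @ [i]) ` (nodes (ts ! i) - {[]})))"
  proof -
    have "insert (v @ [i]) ((@) (v @ [i]) ` (nodes (ts ! i) - {[]})) =
        (\<lambda>w. v @ i # w) ` insert [] (nodes (ts ! i))" for i
      by auto
    then show ?thesis
      by (simp add: insert_absorb root_in_nodes) (auto simp: nodes_PNode)
  qed
  also have "\<dots> = set (map fst ?cs) \<union> (\<Union>(v, t)\<in>set ?cs. (@) v ` (nodes t - {[]}))"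
    by auto
  finally show ?case
    using 2[OF refl] by (simp add: Let_def image_image Un_ac)
qed simp

text \<open>Distinctness is a matter of counting: the list has as many entries as there are nodes,
  and every node occurs. This avoids an invariant along the traversal.\<close>

lemma nfs_order_nodes: "set (nfs_order t) = nodes t" "length (nfs_order t) = num_nodes t"
  and distinct_nfs_order: "distinct (nfs_order t)"
proof -
  show set: "set (nfs_order t) = nodes t"
    using root_in_nodes by (auto simp: nfs_order_def set_nfs_from)
  show len: "length (nfs_order t) = num_nodes t"
    using length_nfs_from[of "[([], t)]"] by (simp add: nfs_order_def)
  show "distinct (nfs_order t)"
    by (rule card_distinct) (simp add: set len card_nodes)
qed

text \<open>\<open>nfs_position\<close> inverts indexing into \<open>nfs_order\<close>, so
  coordinates looked up by position can be read as a list in traversal order.\<close>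

lemma map_nfs_position:
  assumes "length xs = num_nodes t"
  shows "map (\<lambda>v. xs ! nfs_position t v) (nfs_order t) = xs"
proof (rule nth_equalityI)
  fix i
  assume "i < length (map (\<lambda>v. xs ! nfs_position t v) (nfs_order t))"
  then have i: "i < length (nfs_order t)"
    by simp
  have "nfs_position t (nfs_order t ! i) = i"
    unfolding nfs_position_def
    by (rule the_equality) (use i distinct_nfs_order[of t] in \<open>auto simp: nth_eq_iff_index_eq\<close>)
  with i show "map (\<lambda>v. xs ! nfs_position t v) (nfs_order t) ! i = xs ! i"
    by simp
qed (simp add: assms nfs_order_nodes)

lemma is_node_append: "is_node t (v @ w) \<longleftrightarrow> is_node t v \<and> is_node (subtree_at t v) w"
  by (induction t v rule: is_node.induct) auto

lemma subtree_at_append: "is_node t v \<Longrightarrow> subtree_at t (v @ w) = subtree_at (subtree_at t v) w"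
  by (induction t v rule: is_node.induct) auto

section \<open>Cane paths and the recursion for their number\<close>

lemma cane_paths_root: "{vs. cane_path t vs \<and> hd vs = []} = {}"
proof -
  have False if "cane_path t vs" "hd vs = []" for vs
  proof -
    from that obtain k where k: "2 \<le> k" "length vs = k + 1" "\<forall>i<k-1. \<exists>c. vs ! i = vs ! (i+1) @ [c]"
      by (auto simp: cane_path_def)
    then have "vs ! 0 \<noteq> []"
      by fastforce
    moreover have "hd vs = vs ! 0"
      using k by (intro hd_conv_nth) auto
    ultimately show False
      using that by simp
  qed
  then show ?thesis
    by blast
qed

text \<open>After the forced step up to the parent, the path either turns at once to a sibling on
  the right (\<open>k = 2\<close>) or continues as a cane path from the parent.\<close>

lemma cane_path_child_iff:
  assumes "is_node t (v @ [i])"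
  shows "cane_path t vs \<and> hd vs = v @ [i] \<longleftrightarrow>
    (\<exists>j. i < j \<and> is_node t (v @ [j]) \<and> vs = [v @ [i], v, v @ [j]]) \<or>
    (\<exists>ws. cane_path t ws \<and> hd ws = v \<and> vs = (v @ [i]) # ws)" (is "?L \<longleftrightarrow> ?R1 \<or> ?R2")
proof
  assume ?L
  then obtain k where k: "2 \<le> k" "length vs = k + 1" "\<forall>j<k-1. \<exists>c. vs ! j = vs ! (j+1) @ [c]"
    "\<exists>c c'. vs ! (k-2) = vs ! (k-1) @ [c] \<and> vs ! k = vs ! (k-1) @ [c'] \<and> c < c'"
    and sub: "set vs \<subseteq> nodes t" and hd: "hd vs = v @ [i]"
    by (auto simp: cane_path_def)
  from k(1,2) obtain a b c ws where vs: "vs = a # b # c # ws"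
    by (auto simp: numeral_2_eq_2 Suc_le_eq length_Suc_conv dest!: less_imp_Suc_add)
  have a: "a = v @ [i]"
    using hd vs by simp
  have b: "b = v"
    using k(1,3) by (auto simp: vs a dest!: spec[of _ 0])
  show "?R1 \<or> ?R2"
  proof (cases "k = 2")
    case True
    then have "ws = []" "\<exists>j>i. c = v @ [j]"
      using k(2,4) by (auto simp: vs a b)
    then show ?thesis
      using sub by (auto simp: vs a b nodes_def)
  next
    case False
    define k' where "k' = k - 1"
    have k': "k = Suc k'" "2 \<le> k'"
      using k(1) False by (auto simp: k'_def)
    let ?ws = "b # c # ws"
    have "\<exists>d. ?ws ! j = ?ws ! (j + 1) @ [d]" if "j < k' - 1" for j
      using k(3)[rule_format, of "Suc j"] that by (simp add: vs k')
    moreover have "\<exists>d d'. ?ws ! (k' - 2) = ?ws ! (k' - 1) @ [d] \<and> ?ws ! k' = ?ws ! (k' - 1) @ [d'] \<and> d < d'"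
    proof -
      obtain l where l: "k' = Suc (Suc l)"
        using k'(2) by (auto simp: numeral_2_eq_2 Suc_le_eq dest!: less_imp_Suc_add)
      then show ?thesis
        using k(4) by (simp add: vs k')
    qed
    moreover have "length ?ws = k' + 1"
      using k(2) by (simp add: vs k')
    moreover have "set ?ws \<subseteq> nodes t"
      using sub by (simp add: vs)
    ultimately have "cane_path t ?ws"
      using k'(2) unfolding cane_path_def by blast
    then show ?thesis
      by (auto simp: vs a b)
  qed
next
  assume "?R1 \<or> ?R2"
  then show ?L
  proof
    assume ?R1
    then obtain j where j: "i < j" "is_node t (v @ [j])" "vs = [v @ [i], v, v @ [j]]"
      by auto
    have "2 \<le> (2::nat) \<and> length vs = 2 + 1 \<and> (\<forall>l<2-1. \<exists>c. vs ! l = vs ! (l+1) @ [c]) \<and>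
        (\<exists>c c'. vs ! (2-2) = vs ! (2-1) @ [c] \<and> vs ! 2 = vs ! (2-1) @ [c'] \<and> c < c')"
      using j by simp
    moreover have "set vs \<subseteq> nodes t"
      using j assms by (auto simp: nodes_def is_node_append)
    ultimately have "cane_path t vs"
      unfolding cane_path_def by blast
    with j show ?L
      by simp
  next
    assume ?R2
    then obtain ws k where ws: "vs = (v @ [i]) # ws" "hd ws = v" "set ws \<subseteq> nodes t"
      and k: "2 \<le> k" "length ws = k + 1" "\<forall>j<k-1. \<exists>c. ws ! j = ws ! (j+1) @ [c]"
      "\<exists>c c'. ws ! (k-2) = ws ! (k-1) @ [c] \<and> ws ! k = ws ! (k-1) @ [c'] \<and> c < c'"
      by (auto simp: cane_path_def)
    have "ws ! 0 = v"
      using ws(2) k(2) by (subst hd_conv_nth[symmetric]) auto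
    then have "\<forall>j<Suc k - 1. \<exists>c. vs ! j = vs ! (j + 1) @ [c]"
      using k(3) by (auto simp: ws(1) nth_Cons split: nat.split)
    moreover have "\<exists>c c'. vs ! (Suc k - 2) = vs ! (Suc k - 1) @ [c] \<and> vs ! Suc k = vs ! (Suc k - 1) @ [c'] \<and> c < c'"
    proof -
      obtain l where l: "k = Suc (Suc l)"
        using k(1) by (auto simp: numeral_2_eq_2 Suc_le_eq dest!: less_imp_Suc_add)
      then show ?thesis
        using k(4) by (simp add: ws(1))
    qed
    moreover have "2 \<le> Suc k" "length vs = Suc k + 1" "set vs \<subseteq> nodes t"
      using ws(3) assms k(1,2) by (auto simp: ws(1) nodes_def)
    ultimately have "cane_path t vs"
      unfolding cane_path_def by blast
    then show ?L
      by (simp add: ws(1))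
  qed
qed

text \<open>Paths turning at \<open>v\<close> correspond to the siblings further right, all others
  to cane paths from \<open>v\<close>; the kinds are disjoint because a cane path has at least three
  nodes. Finiteness comes first, as the cardinality of an infinite set would be
  \<open>0\<close>.\<close>

lemma finite_cane_paths: "is_node t u \<Longrightarrow> finite {vs. cane_path t vs \<and> hd vs = u}"
  and cane_count_child:
    "is_node t (v @ [i]) \<Longrightarrow>
       cane_count t (v @ [i]) = (length (subtrees (subtree_at t v)) - Suc i) + cane_count t v"
proof -
  have eq: "{vs. cane_path t vs \<and> hd vs = v @ [i]} =
      (\<lambda>j. [v @ [i], v, v @ [j]]) ` {i<..<length (subtrees (subtree_at t v))} \<union>
      (#) (v @ [i]) ` {vs. cane_path t vs \<and> hd vs = v}" if "is_node t (v @ [i])" for v i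
  proof -
    have "is_node t (v @ [j]) \<longleftrightarrow> j < length (subtrees (subtree_at t v))" for j
      using that by (cases "subtree_at t v") (auto simp: is_node_append)
    with that show ?thesis
      by (auto simp: cane_path_child_iff)
  qed
  show fin: "finite {vs. cane_path t vs \<and> hd vs = u}" if "is_node t u" for u
    using that by (induction u rule: rev_induct) (auto simp: cane_paths_root eq is_node_append)
  assume v: "is_node t (v @ [i])"
  have "ws \<noteq> [v, v @ [j]]" if "cane_path t ws" for ws j
    using that by (auto simp: cane_path_def)
  then have "cane_count t (v @ [i]) =
      card ((\<lambda>j. [v @ [i], v, v @ [j]]) ` {i<..<length (subtrees (subtree_at t v))}) +
      card ((#) (v @ [i]) ` {vs. cane_path t vs \<and> hd vs = v})"
    unfolding cane_count_def eq[OF v] using fin[of v] v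
    by (intro card_Un_disjoint) (auto simp: is_node_append)
  then show "cane_count t (v @ [i]) = (length (subtrees (subtree_at t v)) - Suc i) + cane_count t v"
    by (simp add: card_image inj_on_def cane_count_def)
qed

lemma cane_count_root: "cane_count t [] = 0"
  by (simp add: cane_count_def cane_paths_root)

text \<open>The invariant concerns the whole stack: from the top, the cane counts are
  \<open>length stk - 1, ..., 0\<close>. When the active node is popped, its children, counted from
  the right, take over its cane count and continue with consecutive values, so the invariant
  survives.\<close>

lemma cell_nfs_from:
  fixes val :: "node \<Rightarrow> real"
  assumes "\<And>v t. (v, t) \<in> set stk \<Longrightarrow> is_node T v \<and> subtree_at T v = t"
    and "map (cane_count T \<circ> fst) stk = rev [0..<length stk]"
  shows "cell [] (map snd stk) [] 1 u (map val (nfs_from stk)) \<longleftrightarrow>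
    (\<forall>(v, t)\<in>set stk. \<forall>w\<in>nodes t.
       sorted ([1] @ map (\<lambda>u. val u / 2 ^ cane_count T u) (children T (v @ w)) @ [2]))"
  using assms
proof (induction stk arbitrary: u rule: nfs_from.induct)
  case (2 v ts st)
  let ?k = "length ts"
  let ?cs = "map (\<lambda>i. (v @ [i], ts ! i)) [0..<?k]"
  let ?coord = "\<lambda>u. val u / 2 ^ cane_count T u"
  let ?ok = "\<lambda>v. sorted ([1] @ map ?coord (children T v) @ [2])"
  have v: "is_node T v" "subtree_at T v = PNode ts"
    using "2.prems"(1)[of v "PNode ts"] by auto
  have c: "cane_count T v = length st" "map (cane_count T \<circ> fst) st = rev [0..<length st]"
    using "2.prems"(2) by (simp_all add: o_def)
  have child: "is_node T (v @ [i]) \<and> subtree_at T (v @ [i]) = ts ! i \<and>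
      cane_count T (v @ [i]) = (?k - Suc i) + length st" if "i < ?k" for i
  proof -
    have "is_node T (v @ [i])"
      using that v by (simp add: is_node_append)
    with that v c(1) show ?thesis
      by (simp add: subtree_at_append cane_count_child)
  qed
  have "map (cane_count T \<circ> fst) (?cs @ st) = rev [0..<length (?cs @ st)]"
  proof -
    have "map (cane_count T \<circ> fst) ?cs = map (\<lambda>i. (?k - Suc i) + length st) [0..<?k]"
      using child by simp
    also have "\<dots> = rev [length st..<?k + length st]"
      by (rule nth_equalityI) (auto simp: rev_nth)
    finally show ?thesis
      using upt_add_eq_append[of 0 "length st" ?k] by (simp add: c(2) add.commute)
  qed
  moreover have "is_node T v' \<and> subtree_at T v' = t" if "(v', t) \<in> set (?cs @ st)" for v' t
    using that child "2.prems"(1) by auto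
  ultimately have IH: "cell [] (map snd (?cs @ st)) [] 1 u (map val (nfs_from (?cs @ st))) \<longleftrightarrow>
    (\<forall>(v, t)\<in>set (?cs @ st). \<forall>w\<in>nodes t. ?ok (v @ w))" for u
    by (rule "2.IH"[OF refl, rotated])
  have snd_cs: "map snd (?cs @ st) = ts @ map snd st"
    by (simp add: o_def map_nth)
  let ?ys = "map val (map fst (rev ?cs))"
  have "cell [] (map snd ((v, PNode ts) # st)) [] 1 u (map val (nfs_from ((v, PNode ts) # st))) \<longleftrightarrow>
    cell (rev ts) (map snd st) [] 1 (2 ^ Suc (length st)) (?ys @ map val (nfs_from (?cs @ st)))"
    by (simp add: Let_def)
  also have "\<dots> \<longleftrightarrow> chain (2 ^ length st) (2 ^ Suc (length st)) ?ys \<and>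
      cell [] (ts @ map snd st) [] 1 u (map val (nfs_from (?cs @ st)))"
    by (subst cell_children_append[where v = u]) auto
  also have "chain (2 ^ length st) (2 ^ Suc (length st)) ?ys \<longleftrightarrow> ?ok v"
  proof -
    \<comment> \<open>The cane count of a child is its index from the right plus the common height
      \<open>length st\<close>; the common power is factored out and cancelled.\<close>
    have scale: "sorted (map (\<lambda>a. 2 ^ length st * a) zs) \<longleftrightarrow> sorted zs" for zs :: "real list"
      by (simp add: sorted_wrt_map)
    have pow: "(2::real) ^ (?k + length st - Suc i) = 2 ^ (?k - Suc i) * 2 ^ length st" if "i < ?k" for i
      using that by (simp flip: power_add)
    have "rev (map (\<lambda>i. ?ys ! i / 2 ^ i) [0..<length ?ys]) =
        map (\<lambda>a. 2 ^ length st * a) (map ?coord (children T v))"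
      by (rule nth_equalityI) (auto simp: rev_nth children_def v child pow Suc_diff_Suc)
    moreover have "chain (2 ^ length st) (2 ^ Suc (length st)) ?ys \<longleftrightarrow>
        sorted ([2 ^ length st] @ rev (map (\<lambda>i. ?ys ! i / 2 ^ i) [0..<length ?ys]) @ [2 ^ Suc (length st)])"
      by (rule chain_iff_sorted) simp
    ultimately have "chain (2 ^ length st) (2 ^ Suc (length st)) ?ys \<longleftrightarrow>
        sorted (map (\<lambda>a. 2 ^ length st * a) ([1] @ map ?coord (children T v) @ [2]))"
      by (simp add: mult.commute)
    also have "\<dots> \<longleftrightarrow> ?ok v"
      by (rule scale)
    finally show ?thesis .
  qed
  also have "cell [] (ts @ map snd st) [] 1 u (map val (nfs_from (?cs @ st))) \<longleftrightarrow>
      (\<forall>(v, t)\<in>set (?cs @ st). \<forall>w\<in>nodes t. ?ok (v @ w))"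
    using IH snd_cs by simp
  also have "?ok v \<and> \<dots> \<longleftrightarrow>
      (\<forall>(v, t)\<in>set ((v, PNode ts) # st). \<forall>w\<in>nodes t. ?ok (v @ w))"
  proof -
    have "P v \<and> (\<forall>(v, t)\<in>set (?cs @ st). \<forall>w\<in>nodes t. P (v @ w)) \<longleftrightarrow>
        (\<forall>(v, t)\<in>set ((v, PNode ts) # st). \<forall>w\<in>nodes t. P (v @ w))" for P
      by (auto simp: nodes_PNode ball_Un)
    then show ?thesis .
  qed
  finally show ?case .
qed simp

lemma D_tree_cell: "D_tree t = {xs. cell [] [t] [] 1 u xs}"
proof -
  have "xs \<in> D_tree t \<longleftrightarrow> cell [] [t] [] 1 u xs" if len: "length xs = num_nodes t - 1" for xs
  proof -
    let ?val = "\<lambda>v. (1 # xs) ! nfs_position t v"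
    \<comment> \<open>The entry \<open>1\<close> is the coordinate of the root, which has position
      \<open>0\<close>.\<close>
    have "map ?val (nfs_order t) = 1 # xs"
      using len num_nodes_pos[of t] by (intro map_nfs_position) simp
    then have xs: "map ?val (nfs_from [([], t)]) = xs"
      by (simp add: nfs_order_def)
    have "cell [] [t] [] 1 u (map ?val (nfs_from [([], t)])) \<longleftrightarrow>
      (\<forall>w\<in>nodes t. sorted ([1] @ map (\<lambda>u. ?val u / 2 ^ cane_count t u) (children t w) @ [2]))"
      using cell_nfs_from[of "[([], t)]" t u ?val] by (simp add: cane_count_root)
    then show ?thesis
      unfolding xs D_tree_def node_coord_def using len by simp
  qed
  moreover have "length xs = num_nodes t - 1" if "cell [] [t] [] 1 u xs" for xs
    using cell_total_nodes[OF that] by simp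
  ultimately show ?thesis
    by (auto simp: D_tree_def)
qed

lemma D_list_cell: "D_list (t # F) = {xs. cell [] [t] F 1 u xs}"
proof (induction F arbitrary: t)
  case Nil
  then show ?case
    by (simp add: D_tree_cell[of _ u])
next
  case (Cons t' F)
  show ?case
    using cell_split_component[of "[]" "[t]" "t' # F" 1 u _ u]
    by (auto simp: Cons.IH D_tree_cell[of _ u] cone_over_cell[where v = u])
qed

subsection \<open>Existence and uniqueness of the cell\<close>

text \<open>The trees are built backwards: the subtrees that the remaining coordinates determine are
  packed into a node when a pop or a new component is decided. The inner induction on
  \<open>c\<close> is there because several pops can precede one coordinate.\<close>

lemma cell_exists:
  "0 \<le> s \<Longrightarrow> 2 ^ c * s \<le> u \<Longrightarrow> chain 0 u xs \<Longrightarrow> \<exists>rs st F. length st = c \<and> cell rs st F s u xs"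
proof (induction "length xs" arbitrary: c s u xs)
  case 0
  \<comment> \<open>With no coordinate left, every waiting node is a leaf.\<close>
  have "\<exists>st. length st = c \<and> cell [] st [] s u []" for u
  proof (induction c arbitrary: u)
    case (Suc c)
    then obtain st where "length st = c" "cell [] st [] s (2 ^ Suc c * s) []"
      by blast
    then show ?case
      by (intro exI[of _ "PNode [] # st"]) auto
  qed simp
  moreover have "xs = []"
    using 0 by simp
  ultimately show ?case
    by blast
next
  case (Suc l)
  then obtain x ys where xs: "xs = x # ys" "l = length ys"
    by (metis length_Suc_conv)
  show ?case
    using Suc.prems
  proof (induction c arbitrary: u)
    case 0
    show ?case
    proof (cases "s \<le> x")
      case True
      with 0 xs Suc.hyps(1)[of ys s 1 "2 * x"]
      obtain rs st F where "length st = 1" "cell rs st F s (2 * x) ys"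
        by auto
      then obtain t where "st = [t]" "cell rs [t] F s (2 * x) ys"
        by (auto simp: length_Suc_conv)
      with 0 xs True have "cell (t # rs) [] F s u xs"
        by simp
      then show ?thesis
        by blast
    next
      case False
      with 0 xs Suc.hyps(1)[of ys x 0 "2 * x"]
      obtain rs F where "cell rs [] F x (2 * x) ys"
        by auto
      then have "cell [] [] (PNode (rev rs) # F) s u xs"
        using False 0 xs by simp
      then show ?thesis
        by blast
    qed
  next
    case (Suc c)
    show ?case
    proof (cases "2 ^ Suc c * s \<le> x")
      case True
      then have "2 ^ Suc (Suc c) * s \<le> 2 * x"
        by (simp add: algebra_simps)
      moreover have "chain 0 (2 * x) ys"
        using Suc.prems xs by simp
      ultimately obtain rs st F where "length st = Suc (Suc c)" "cell rs st F s (2 * x) ys"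
        using Suc.hyps(1)[OF xs(2) Suc.prems(1)] by blast
      then obtain t st' where "length st' = Suc c" "cell rs (t # st') F s (2 * x) ys"
        by (auto simp: length_Suc_conv)
      with Suc.prems xs True have "cell (t # rs) st' F s u xs" "length st' = Suc c"
        by simp_all
      then show ?thesis
        by blast
    next
      case False
      with Suc.prems xs have "chain 0 (2 ^ Suc c * s) xs"
        by simp
      moreover have "2 ^ c * s \<le> 2 ^ Suc c * s"
        using Suc.prems(1) by simp
      ultimately obtain rs st F where "length st = c" "cell rs st F s (2 ^ Suc c * s) xs"
        using Suc.IH Suc.prems(1) by blast
      then have "length (PNode (rev rs) # st) = Suc c" "cell [] (PNode (rev rs) # st) F s u xs"
        by simp_all
      then show ?thesis
        by blast
    qed
  qed
qed

text \<open>
  Off the walls \<open>x\<^sub>j = 2\<^sup>c x\<^sub>i\<close> (\<open>i < j\<close>), the comparison of the next coordinate with the threshold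
  \<open>2 ^ length st * s\<close> decides whether it belongs to a further child of the active node.
\<close>

abbreviation generic :: "real list \<Rightarrow> bool" where
  "generic \<equiv> sorted_wrt (\<lambda>a b. \<forall>c. b \<noteq> 2 ^ c * a)"

text \<open>The bound is irrelevant here and may be set to the threshold, the least value for which
  \<open>cell_nonneg\<close> applies.\<close>

lemma cell_pop_bound:
  assumes "cell [] st F s u (x # xs)" "0 \<le> s"
  shows "x \<le> 2 ^ length st * s"
proof -
  have "chain 0 (2 ^ length st * s) (x # xs)"
    using assms cell_bound_irrelevant by (blast intro: cell_nonneg)
  then show ?thesis
    by simp
qed

text \<open>If one reading takes a child where the other pops or starts a component, the next
  coordinate is both at least and at most the threshold, hence on a wall. The scale heads the
  generic list because it is the earlier value in that wall; a new component replaces it by its own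
  root.\<close>

lemma cell_unique:
  assumes "cell rs st F s u xs" "cell rs' st' F' s v xs" "length st = length st'"
    "generic (s # xs)" "0 \<le> s"
  shows "rs = rs' \<and> st = st' \<and> F = F'"
  using assms
proof (induction rs st F s u xs arbitrary: rs' st' F' v rule: cell.induct)
  case (1 s u xs)
  then show ?case
    by (cases rs'; cases F'; cases "hd F'") auto
next
  case (3 ts F s u x xs)
  then have st': "st' = []"
    by simp
  have "rs' = []"
  proof (cases rs')
    case (Cons t rs)
    with 3 st' have "x = s"
      by auto
    with 3 show ?thesis
      by (auto dest: spec[of _ 0])
  qed
  with 3 st' obtain ts' F'' where F': "F' = PNode ts' # F''"
    by (cases F'; cases "hd F'") auto
  with 3 \<open>rs' = []\<close> st' have "rev ts = rev ts' \<and> F = F''"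
    by (intro "3.IH"[THEN conjunct1, THEN conjI] "3.IH"[THEN conjunct2, THEN conjunct2]) auto
  with F' \<open>rs' = []\<close> st' show ?case
    by simp
next
  case (4 ts st F s u xs)
  then obtain t'' st'' where st': "st' = t'' # st''"
    by (cases st') auto
  then obtain ts' where t'': "t'' = PNode ts'"
    by (cases t'')
  have "rs' = []"
  proof (cases rs')
    case (Cons t rs)
    with "4.prems" obtain x ys where x: "xs = x # ys" "2 ^ length st' * s \<le> x"
      by (auto simp: cell_Cons)
    moreover have "x \<le> 2 ^ length (PNode ts # st) * s"
      by (rule cell_pop_bound[OF "4.prems"(1)[unfolded x(1)] "4.prems"(5)])
    ultimately have "x = 2 ^ length st' * s"
      using x(2) "4.prems"(3) by (metis order_antisym)
    with x "4.prems"(4) show ?thesis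
      by auto
  qed
  with 4 st' t'' have "rev ts = rev ts' \<and> st = st'' \<and> F = F'"
    by (intro "4.IH") auto
  with t'' \<open>rs' = []\<close> st' show ?case
    by simp
next
  case (6 t rs st F s u x xs)
  show ?case
  proof (cases rs')
    case Nil
    with "6.prems" have "x = 2 ^ length st * s"
      using cell_pop_bound[of st' F' s v x xs] by auto
    with "6.prems"(4) show ?thesis
      by auto
  next
    case (Cons t' rs'')
    with 6 have "rs = rs'' \<and> t # st = t' # st' \<and> F = F'"
      by (intro "6.IH"[of rs'' "t' # st'" F' "2 * x"]) auto
    with Cons show ?thesis
      by simp
  qed
qed auto

subsection \<open>Polyhedral structure\<close>

definition affine_functional :: "('a::real_inner \<Rightarrow> real) \<Rightarrow> bool" where
  "affine_functional f \<longleftrightarrow> (\<exists>a b. \<forall>x. f x = a \<bullet> x + b)"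

lemma affine_functional_const [simp]: "affine_functional (\<lambda>_ :: 'a::real_inner. b)"
proof -
  have "b = 0 \<bullet> x + b" for x :: 'a
    by simp
  then show ?thesis
    unfolding affine_functional_def by blast
qed

lemma affine_functional_mult [simp]:
  assumes "affine_functional f"
  shows "affine_functional (\<lambda>x. k * f x)"
proof -
  from assms obtain a b where "f x = a \<bullet> x + b" for x
    by (auto simp: affine_functional_def)
  then have "k * f x = (k *\<^sub>R a) \<bullet> x + k * b" for x
    by (simp add: distrib_left)
  then show ?thesis
    unfolding affine_functional_def by blast
qed

lemma polyhedron_affine_le:
  fixes f g :: "'a::euclidean_space \<Rightarrow> real"
  assumes "affine_functional f" "affine_functional g"
  shows "polyhedron {x. f x \<le> g x}"
proof -
  from assms obtain a b a' b' where "f x = a \<bullet> x + b" "g x = a' \<bullet> x + b'" for x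
    by (auto simp: affine_functional_def)
  then have "{x. f x \<le> g x} = {x. (a - a') \<bullet> x \<le> b' - b}"
    by (auto simp: inner_diff_left algebra_simps)
  then show ?thesis
    by (simp add: polyhedron_halfspace_le)
qed

lemma polyhedron_conj:
  "polyhedron {x. P x} \<Longrightarrow> polyhedron {x. Q x} \<Longrightarrow> polyhedron {x. P x \<and> Q x}"
  using polyhedron_Int[of "{x. P x}" "{x. Q x}"] by (simp add: Collect_conj_eq)

lemma polyhedron_chain:
  fixes l u :: "'a::euclidean_space \<Rightarrow> real"
  assumes "affine_functional l" "affine_functional u" "\<forall>f\<in>set fs. affine_functional f"
  shows "polyhedron {x. chain (l x) (u x) (map (\<lambda>f. f x) fs)}"
  using assms by (induction fs arbitrary: l u) (auto intro!: polyhedron_conj polyhedron_affine_le)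

text \<open>Scale and bound are functions of the point because they become multiples of earlier
  coordinates during the reading; each comparison then adds one affine inequality.\<close>

lemma polyhedron_cell:
  fixes s u :: "'a::euclidean_space \<Rightarrow> real"
  assumes "affine_functional s" "affine_functional u" "\<forall>f\<in>set fs. affine_functional f"
  shows "polyhedron {x. cell rs st F (s x) (u x) (map (\<lambda>f. f x) fs)}"
  using assms
proof (induction "2 * total_nodes rs + (\<Sum>t\<leftarrow>st. 2 * num_nodes t - 1) + 2 * total_nodes F"
    arbitrary: rs st F s u fs rule: less_induct)
  case less
  show ?case
  proof (cases rs)
    case (Cons t rs')
    have "2 * total_nodes rs' + (\<Sum>t\<leftarrow>t # st. 2 * num_nodes t - 1) + 2 * total_nodes F
        < 2 * total_nodes rs + (\<Sum>t\<leftarrow>st. 2 * num_nodes t - 1) + 2 * total_nodes F"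
      using Cons num_nodes_pos[of t] by simp
    from less(1)[OF this] less(2-4) show ?thesis
      by (cases fs) (auto simp: Cons intro!: polyhedron_conj polyhedron_affine_le)
  next
    case rs: Nil
    show ?thesis
    proof (cases st)
      case (Cons t st')
      obtain ts where t: "t = PNode ts"
        by (cases t)
      have "2 * total_nodes (rev ts) + (\<Sum>t\<leftarrow>st'. 2 * num_nodes t - 1) + 2 * total_nodes F
          < 2 * total_nodes rs + (\<Sum>t\<leftarrow>st. 2 * num_nodes t - 1) + 2 * total_nodes F"
        using Cons rs t by (simp add: sum_list_rev flip: rev_map)
      from less(1)[OF this] less(2-4) show ?thesis
        by (auto simp: rs Cons t)
    next
      case st: Nil
      show ?thesis
      proof (cases F)
        case (Cons t F')
        obtain ts where t: "t = PNode ts"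
          by (cases t)
        have "2 * total_nodes (rev ts) + (\<Sum>t\<leftarrow>[]. 2 * num_nodes t - 1) + 2 * total_nodes F'
            < 2 * total_nodes rs + (\<Sum>t\<leftarrow>st. 2 * num_nodes t - 1) + 2 * total_nodes F"
          using Cons rs t st by (simp add: sum_list_rev flip: rev_map)
        from less(1)[OF this] less(2-4) show ?thesis
          by (cases fs) (auto simp: rs Cons t st intro!: polyhedron_conj polyhedron_affine_le)
      qed (simp add: rs st)
    qed
  qed
qed

section \<open>Vectors, coordinate lists and the Gayley polytope\<close>

lemma coord_list_alt:
  "coord_list e x = map (\<lambda>f. f x) (map (\<lambda>i x. x $ e i) [1..<CARD('n) + 1])"
  for e :: "nat \<Rightarrow> 'n::finite"
  by (simp add: coord_list_def o_def)

lemma length_coord_list [simp]: "length (coord_list e x) = CARD('n)"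
  for x :: "real ^ 'n"
  by (simp add: coord_list_def)

lemma nth_coord_list [simp]: "i < CARD('n) \<Longrightarrow> coord_list e x ! i = x $ e (Suc i)"
  for x :: "real ^ 'n"
  by (simp add: coord_list_def del: upt_Suc)

lemma affine_functional_coord: "affine_functional (\<lambda>x :: real ^ 'n. x $ i)"
  unfolding affine_functional_def
  by (intro exI[of _ "axis i 1"] exI[of _ 0]) (simp add: inner_axis inner_commute)

lemma chain_zero_iff:
  "chain 0 u xs \<longleftrightarrow>
    (\<forall>i<length xs. 0 \<le> xs ! i \<and> xs ! i \<le> (if i = 0 then u else 2 * xs ! (i - 1)))"
proof (induction xs arbitrary: u)
  case (Cons x xs)
  show ?case
    using Cons by (simp add: All_less_Suc2 nth_Cons' cong: if_cong)
qed simp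

lemma chain_zero_bound: "chain 0 u xs \<Longrightarrow> i < length xs \<Longrightarrow> 0 \<le> xs ! i \<and> xs ! i \<le> 2 ^ i * u"
proof (induction xs arbitrary: u i)
  case (Cons x xs)
  show ?case
  proof (cases i)
    case (Suc j)
    with Cons.prems Cons.IH[of "2 * x" j] have "0 \<le> xs ! j \<and> xs ! j \<le> 2 ^ j * (2 * x)"
      by simp
    moreover have "2 ^ j * (2 * x) \<le> 2 ^ j * (2 * u)"
      using Cons.prems by simp
    ultimately have "0 \<le> xs ! j \<and> xs ! j \<le> 2 ^ j * (2 * u)"
      by linarith
    then show ?thesis
      using Suc by (simp add: mult.left_commute mult.assoc)
  qed (use Cons.prems in simp)
qed simp

lemma Gayley_chain: "Gayley e = {x. chain 0 2 (coord_list e x)}"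
  for e :: "nat \<Rightarrow> 'n::finite"
proof -
  have "x \<in> Gayley e \<longleftrightarrow> chain 0 2 (coord_list e x)" for x :: "real ^ 'n"
  proof -
    have "(\<forall>i<CARD('n). P i) \<longleftrightarrow> P 0 \<and> (\<forall>i\<in>{2..CARD('n)}. P (i - 1))" for P :: "nat \<Rightarrow> bool"
    proof
      assume P: "P 0 \<and> (\<forall>i\<in>{2..CARD('n)}. P (i - 1))"
      show "\<forall>i<CARD('n). P i"
      proof (intro allI impI)
        fix i
        assume "i < CARD('n)"
        with P show "P i"
          by (cases i) (auto dest: bspec[of _ _ "Suc i"])
      qed
    qed auto
    note split = this
    have "(0 \<le> coord_list e x ! (i - 1) \<and>
        coord_list e x ! (i - 1) \<le> (if i - 1 = 0 then 2 else 2 * coord_list e x ! (i - 1 - 1))) \<longleftrightarrow>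
        (0 \<le> x $ e i \<and> x $ e i \<le> 2 * x $ e (i - 1))" if "i \<in> {2..CARD('n)}" for i
    proof -
      have "i = Suc (Suc (i - 2))"
        using that by auto
      then obtain j where "i = Suc (Suc j)" ..
      with that show ?thesis
        by simp
    qed
    then have coords: "(\<forall>i\<in>{2..CARD('n)}. 0 \<le> coord_list e x ! (i - 1) \<and>
        coord_list e x ! (i - 1) \<le> (if i - 1 = 0 then 2 else 2 * coord_list e x ! (i - 1 - 1))) \<longleftrightarrow>
        (\<forall>i\<in>{2..CARD('n)}. 0 \<le> x $ e i \<and> x $ e i \<le> 2 * x $ e (i - 1))"
      by (intro ball_cong refl)
    show ?thesis
      unfolding Gayley_def chain_zero_iff length_coord_list split using coords by simp
  qed
  then show ?thesis
    by blast
qed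

lemma D_forest_cell: "D_forest e (t # F) = {x. cell [] [t] F 1 u (coord_list e x)}"
  for e :: "nat \<Rightarrow> 'n::finite"
  by (auto simp: D_forest_def D_list_cell[of _ _ u])

lemma D_forest_subset_Gayley: "D_forest e (t # F) \<subseteq> Gayley e"
  for e :: "nat \<Rightarrow> 'n::finite"
proof
  fix x
  assume "x \<in> D_forest e (t # F)"
  then have "cell [] [t] F 1 2 (coord_list e x)"
    by (simp add: D_forest_cell[of _ _ _ 2])
  then show "x \<in> Gayley e"
    unfolding Gayley_chain by (auto dest: cell_nonneg)
qed

lemma plane_forests_nonempty: "F \<in> plane_forests (n + 1) \<Longrightarrow> \<exists>t F'. F = t # F'"
  by (cases F) (auto simp: plane_forests_def)

context
  fixes e :: "nat \<Rightarrow> 'n::finite"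
  assumes e: "bij_betw e {1..CARD('n)} UNIV"
begin

lemma polytope_Gayley: "polytope (Gayley e)"
proof -
  have "Gayley e \<subseteq> cbox 0 (\<chi> i. 2 ^ CARD('n) * 2)"
  proof
    fix x
    assume "x \<in> Gayley e"
    then have x: "chain 0 2 (coord_list e x)"
      by (simp add: Gayley_chain)
    have "0 \<le> x $ k \<and> x $ k \<le> 2 ^ CARD('n) * 2" for k
    proof -
      obtain i where "i \<in> {1..CARD('n)}" "k = e i"
        using e by (metis UNIV_I bij_betw_imp_surj_on imageE)
      then have "i - 1 < CARD('n)" "k = e (Suc (i - 1))"
        by auto
      then obtain i where i: "i < CARD('n)" "k = e (Suc i)" ..
      then have "0 \<le> x $ k \<and> x $ k \<le> 2 ^ i * 2"
        using chain_zero_bound[OF x, of i] by simp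
      moreover have "(2::real) ^ i \<le> 2 ^ CARD('n)"
        using i by (intro power_increasing) auto
      ultimately show ?thesis
        by linarith
    qed
    then show "x \<in> cbox 0 (\<chi> i. 2 ^ CARD('n) * 2)"
      by (simp add: mem_box_cart)
  qed
  then have "bounded (Gayley e)"
    using bounded_cbox bounded_subset by blast
  moreover have "polyhedron (Gayley e)"
    unfolding Gayley_chain coord_list_alt
    by (rule polyhedron_chain[of "\<lambda>_. 0" "\<lambda>_. 2"]) (auto simp: affine_functional_coord)
  ultimately show ?thesis
    by (simp add: polytope_eq_bounded_polyhedron)
qed

lemma polytope_D_forest: "polytope (D_forest e (t # F))"
proof -
  have "polyhedron (D_forest e (t # F))"
    unfolding D_forest_cell[of _ _ _ 2] coord_list_alt
    by (rule polyhedron_cell[of "\<lambda>_. 1" "\<lambda>_. 2"]) (auto simp: affine_functional_coord)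
  moreover have "bounded (D_forest e (t # F))"
    by (rule bounded_subset[OF polytope_imp_bounded[OF polytope_Gayley] D_forest_subset_Gayley])
  ultimately show ?thesis
    by (simp add: polytope_eq_bounded_polyhedron)
qed

lemma Union_D_forest: "\<Union> (D_forest e ` plane_forests (CARD('n) + 1)) = Gayley e"
proof
  show "\<Union> (D_forest e ` plane_forests (CARD('n) + 1)) \<subseteq> Gayley e"
    using D_forest_subset_Gayley plane_forests_nonempty by fastforce
  show "Gayley e \<subseteq> \<Union> (D_forest e ` plane_forests (CARD('n) + 1))"
  proof
    fix x
    assume "x \<in> Gayley e"
    then have "chain 0 2 (coord_list e x)"
      by (simp add: Gayley_chain)
    \<comment> \<open>Empty stack, scale \<open>1\<close> and bound \<open>2\<close> describe the
      moment after the first root, with coordinate \<open>1\<close>, has become active;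
      \<open>rs\<close> are its subtrees from the right.\<close>
    then obtain rs F where "cell rs [] F 1 2 (coord_list e x)"
      using cell_exists[of 1 0 2 "coord_list e x"] by auto
    then have *: "cell [] [PNode (rev rs)] F 1 2 (coord_list e x)"
      by simp
    have "PNode (rev rs) # F \<in> plane_forests (CARD('n) + 1)"
      using cell_total_nodes[OF *] by (simp add: plane_forests_def)
    moreover have "x \<in> D_forest e (PNode (rev rs) # F)"
      using * by (simp add: D_forest_cell[of _ _ _ 2])
    ultimately show "x \<in> \<Union> (D_forest e ` plane_forests (CARD('n) + 1))"
      by blast
  qed
qed

text \<open>Genericity fails only on the countably many sets \<open>y_j = 2 ^ c * y_i\<close> with
  \<open>i < j\<close>. Index \<open>0\<close> stands for the constant \<open>1\<close> and gives a
  hyperplane off the origin; otherwise injectivity of \<open>e\<close> makes the normal vector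
  nonzero.\<close>

lemma negligible_not_generic: "negligible {x. \<not> generic (1 # coord_list e x)}"
proof -
  let ?y = "\<lambda>x i. (1 # coord_list e x) ! i"
  let ?W = "\<lambda>(i, j, c). {x. i < j \<and> j \<le> CARD('n) \<and> ?y x j = 2 ^ c * ?y x i}"
  have "negligible (?W (i, j, c))" for i j c :: nat
  proof (cases "i < j \<and> j \<le> CARD('n)")
    case True
    then obtain j' where j: "j = Suc j'" "j' < CARD('n)"
      by (cases j) auto
    show ?thesis
    proof (cases i)
      case 0
      then have "?W (i, j, c) = {x. axis (e j) 1 \<bullet> x = 2 ^ c}"
        using j by (auto simp: inner_axis inner_commute)
      then show ?thesis
        using negligible_hyperplane[of "axis (e j) 1" "2 ^ c"] by simp
    next
      case (Suc i')
      have "e i \<noteq> e j"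
        using e True Suc by (auto simp: bij_betw_def inj_on_eq_iff)
      then have "(axis (e j) 1 - 2 ^ c *\<^sub>R axis (e i) 1) $ e j = (1::real)"
        by (simp add: axis_def)
      then have "axis (e j) 1 - 2 ^ c *\<^sub>R axis (e i) (1::real) \<noteq> 0"
        by (metis zero_index zero_neq_one)
      moreover have "?W (i, j, c) = {x. (axis (e j) 1 - 2 ^ c *\<^sub>R axis (e i) 1) \<bullet> x = 0}"
        using j Suc True by (auto simp: inner_diff_left inner_axis')
      ultimately show ?thesis
        using negligible_hyperplane[of "axis (e j) 1 - 2 ^ c *\<^sub>R axis (e i) 1" 0] by simp
    qed
  next
    case False
    then have "?W (i, j, c) = {}"
      by auto
    then show ?thesis
      by (simp only: negligible_empty)
  qed
  then have "negligible (\<Union> (range ?W))"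
    by (intro negligible_countable_Union) auto
  moreover have "{x. \<not> generic (1 # coord_list e x)} \<subseteq> \<Union> (range ?W)"
  proof
    fix x
    assume "x \<in> {x. \<not> generic (1 # coord_list e x)}"
    then obtain i j c where "i < j" "j < Suc CARD('n)" "?y x j = 2 ^ c * ?y x i"
      unfolding mem_Collect_eq sorted_wrt_iff_nth_less by auto
    then have "x \<in> ?W (i, j, c)"
      by simp
    then show "x \<in> \<Union> (range ?W)"
      by blast
  qed
  ultimately show ?thesis
    by (rule negligible_subset)
qed

lemma negligible_D_forest_Int:
  assumes "t # F \<noteq> t' # F'"
  shows "negligible (D_forest e (t # F) \<inter> D_forest e (t' # F'))"
proof (rule negligible_subset[OF negligible_not_generic], rule subsetI)
  fix x
  assume "x \<in> D_forest e (t # F) \<inter> D_forest e (t' # F')"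
  then have "cell [] [t] F 1 2 (coord_list e x)" "cell [] [t'] F' 1 2 (coord_list e x)"
    by (auto simp: D_forest_cell[of _ _ _ 2])
  from cell_unique[OF this] assms show "x \<in> {x. \<not> generic (1 # coord_list e x)}"
    by auto
qed

end

subsection \<open>Volumes\<close>

text \<open>The first entry is the outermost variable, matching the order in which
  \<open>cell\<close> consumes coordinates.\<close>

primrec iterated_integral :: "nat \<Rightarrow> (real list \<Rightarrow> ennreal) \<Rightarrow> ennreal" where
  "iterated_integral 0 f = f []"
| "iterated_integral (Suc n) f = (\<integral>\<^sup>+x. iterated_integral n (\<lambda>xs. f (x # xs)) \<partial>lborel)"

lemma iterated_integral_zero [simp]: "iterated_integral n (\<lambda>_. 0) = 0"
  by (induction n) auto

text \<open>Tonelli along the list; slices inherit measurability because updating one index is a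
  measurable map.\<close>

lemma nn_integral_PiM_list:
  assumes "distinct js"
    and "(\<lambda>g. f (map g js)) \<in> borel_measurable (PiM (set js) (\<lambda>_. lborel))"
  shows "(\<integral>\<^sup>+g. f (map g js) \<partial>PiM (set js) (\<lambda>_. lborel)) = iterated_integral (length js) f"
  using assms
proof (induction "js" arbitrary: f)
  case Nil
  interpret product_sigma_finite "\<lambda>_. lborel" ..
  show ?case
    using nn_integral_empty[of "\<lambda>_. f []"] by simp
next
  case (Cons i js)
  interpret product_sigma_finite "\<lambda>_. lborel" ..
  have upd: "map (g(i := y)) js = map g js" for g y
    using Cons.prems(1) by auto
  have meas: "(\<lambda>g. f (map g (i # js))) \<in> borel_measurable (PiM (insert i (set js)) (\<lambda>_. lborel))"
    using Cons.prems(2) by simp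
  have "(\<integral>\<^sup>+g. f (map g (i # js)) \<partial>PiM (insert i (set js)) (\<lambda>_. lborel)) =
      (\<integral>\<^sup>+y. \<integral>\<^sup>+g. f (map (g(i := y)) (i # js)) \<partial>PiM (set js) (\<lambda>_. lborel) \<partial>lborel)"
    using Cons.prems(1) by (intro product_nn_integral_insert_rev meas) auto
  also have "\<dots> = (\<integral>\<^sup>+y. \<integral>\<^sup>+g. f (y # map g js) \<partial>PiM (set js) (\<lambda>_. lborel) \<partial>lborel)"
    by (simp only: list.map upd fun_upd_same)
  also have "\<dots> = (\<integral>\<^sup>+y. iterated_integral (length js) (\<lambda>xs. f (y # xs)) \<partial>lborel)"
  proof (intro nn_integral_cong Cons.IH)
    fix y :: real
    have "(\<lambda>g. g(i := y)) \<in> measurable (PiM (set js) (\<lambda>_. lborel)) (PiM (insert i (set js)) (\<lambda>_. lborel))"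
      by (rule measurable_fun_upd[where J = "set js"]) auto
    from measurable_compose[OF this meas]
    show "(\<lambda>g. f (y # map g js)) \<in> borel_measurable (PiM (set js) (\<lambda>_. lborel))"
      by (simp only: list.map upd fun_upd_same)
  qed (use Cons.prems(1) in simp)
  finally show ?case
    by simp
qed

text \<open>\<open>lborel\<close> is the image of a product measure indexed by the basis; the basis
  vectors are listed in the order that \<open>e\<close> prescribes.\<close>

lemma emeasure_coord_list:
  fixes e :: "nat \<Rightarrow> 'n::finite"
  assumes e: "bij_betw e {1..CARD('n)} UNIV" and meas: "{x. P (coord_list e x)} \<in> sets borel"
  shows "emeasure lborel {x. P (coord_list e x)} =
    iterated_integral CARD('n) (\<lambda>xs. if P xs then 1 else 0)"
proof -
  let ?M = "PiM Basis (\<lambda>_. lborel) :: (real ^ 'n \<Rightarrow> real) measure"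
  let ?T = "\<lambda>g. \<Sum>b\<in>Basis. g b *\<^sub>R b :: real ^ 'n"
  let ?js = "map (\<lambda>i. axis (e i) 1 :: real ^ 'n) [1..<CARD('n) + 1]"
  have T: "?T \<in> measurable ?M borel"
    by measurable
  have "set [1..<CARD('n) + 1] = {1..CARD('n)}"
    by auto
  then have "set ?js = (\<lambda>k. axis k 1) ` e ` {1..CARD('n)}"
    by (simp only: list.set_map image_image)
  also have "\<dots> = Basis"
    using e by (auto simp: bij_betw_def Basis_vec_def)
  finally have set: "set ?js = Basis" .
  have "inj_on e {1..<CARD('n) + 1}"
    using e by (auto simp: bij_betw_def atLeastLessThanSuc_atLeastAtMost)
  then have distinct: "distinct ?js"
    unfolding distinct_map set_upt
    by (auto intro!: inj_onI simp only: axis_eq_axis distinct_upt dest: inj_onD)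
  have coord: "coord_list e (?T g) = map g ?js" for g
  proof -
    have "?T g $ k = g (axis k 1)" for k
    proof -
      have "?T g $ k = ?T g \<bullet> axis k 1"
        by (simp add: inner_axis)
      also have "\<dots> = g (axis k 1)"
        by (rule inner_sum_left_Basis) simp
      finally show ?thesis .
    qed
    then show ?thesis
      by (simp add: coord_list_def)
  qed
  have [measurable]: "Measurable.pred borel (\<lambda>x. P (coord_list e x))"
    using meas by (simp add: pred_def)
  have ind: "(\<lambda>x. if P (coord_list e x) then 1 else 0 :: ennreal) \<in> borel_measurable borel"
    by measurable
  have "emeasure lborel {x. P (coord_list e x)} = (\<integral>\<^sup>+x. indicator {x. P (coord_list e x)} x \<partial>lborel)"
    using meas by simp
  also have "\<dots> = (\<integral>\<^sup>+x. (if P (coord_list e x) then 1 else 0) \<partial>lborel)"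
    by (intro nn_integral_cong) (simp add: indicator_def)
  also have "\<dots> = (\<integral>\<^sup>+g. (if P (coord_list e (?T g)) then 1 else 0) \<partial>?M)"
    unfolding lborel_eq[where 'a = "real ^ 'n"] by (rule nn_integral_distr[OF T]) (simp add: ind)
  also have "\<dots> = (\<integral>\<^sup>+g. (if P (map g ?js) then 1 else 0) \<partial>PiM (set ?js) (\<lambda>_. lborel))"
    unfolding coord set ..
  also have "\<dots> = iterated_integral (length ?js) (\<lambda>xs. if P xs then 1 else 0)"
  proof (rule nn_integral_PiM_list[OF distinct])
    show "(\<lambda>g. if P (map g ?js) then 1 else 0 :: ennreal) \<in> borel_measurable (PiM (set ?js) (\<lambda>_. lborel))"
      using measurable_compose[OF T ind] unfolding coord set .
  qed
  finally show ?thesis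
    by simp
qed

lemma iterated_integral_Cons:
  fixes G :: "real \<Rightarrow> real"
  assumes "a \<le> b"
    and "\<And>x. a \<le> x \<Longrightarrow> x \<le> b \<Longrightarrow>
      iterated_integral n (\<lambda>xs. if P x xs then 1 else 0) = ennreal (g x)"
    and "\<And>x. a \<le> x \<Longrightarrow> x \<le> b \<Longrightarrow> 0 \<le> g x"
    and "\<And>x. (G has_real_derivative g x) (at x)"
    and "g \<in> borel_measurable borel"
  shows "iterated_integral (Suc n)
      (\<lambda>xs. if a \<le> hd xs \<and> hd xs \<le> b \<and> P (hd xs) (tl xs) then 1 else 0) = ennreal (G b - G a)"
proof -
  have "iterated_integral n (\<lambda>xs. if a \<le> x \<and> x \<le> b \<and> P x xs then 1 else 0) =
      ennreal (g x) * indicator {a..b} x" for x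
    using assms(2)[of x] by (auto simp: indicator_def)
  then have "iterated_integral (Suc n)
      (\<lambda>xs. if a \<le> hd xs \<and> hd xs \<le> b \<and> P (hd xs) (tl xs) then 1 else 0) =
      (\<integral>\<^sup>+x. ennreal (g x) * indicator {a..b} x \<partial>lborel)"
    by (simp del: indicator_simps)
  also have "\<dots> = ennreal (G b - G a)"
    using assms by (intro nn_integral_FTC_Icc) (auto simp: has_field_derivative_at_within)
  finally show ?thesis .
qed

text \<open>The volume at scale \<open>1\<close> when the active node has no child left to read. A
  family of \<open>k\<close> children above \<open>l\<close> waiting nodes contributes
  \<open>2 ^ (l * k + (k choose 2)) / fact k\<close>. A new component contributes
  \<open>1 / N\<close>, with \<open>N\<close> the number of nodes left, from integrating the power
  \<open>x ^ (N - 1)\<close> of its root coordinate.\<close>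

function vol_const :: "plane_tree list \<Rightarrow> plane_forest \<Rightarrow> real" where
  "vol_const [] [] = 1"
| "vol_const [] (t # F) = vol_const [t] F / total_nodes (t # F)"
| "vol_const (PNode ts # st) F =
     2 ^ (length st * length ts + (length ts choose 2)) / fact (length ts) * vol_const (ts @ st) F"
  by pat_completeness auto
termination
  by (relation "Wellfounded.measure (\<lambda>(st, F). total_nodes st + 2 * total_nodes F)")
    (auto simp: num_nodes_pos)

lemma vol_const_pos: "0 < vol_const st F"
  by (induction st F rule: vol_const.induct) (auto simp: num_nodes_pos add_pos_nonneg)

lemma Suc_choose_2: "Suc k choose 2 = k + (k choose 2)"
  by (simp add: numeral_2_eq_2)

lemma length_le_total_nodes: "length ts \<le> total_nodes ts"
proof (induction ts)
  case (Cons t ts)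
  then show ?case
    using num_nodes_pos[of t] by simp
qed simp

lemma DERIV_power_antiderivative:
  fixes C :: real
  shows "((\<lambda>x. C * (x - l) ^ Suc k / Suc k) has_real_derivative C * (x - l) ^ k) (at x)"
proof -
  have "((\<lambda>x. (x - l) ^ Suc k) has_real_derivative real (Suc k) * (x - l) ^ k) (at x)"
    by (auto intro!: derivative_eq_intros simp del: power_Suc)
  from DERIV_cdivide[OF DERIV_cmult[OF this, of C], of "real (Suc k)"] show ?thesis
    by (simp del: power_Suc of_nat_Suc)
qed

text \<open>The result is homogeneous of degree \<open>r\<close>. Only the current family sees
  \<open>u\<close>, which gives a power of the gap to the threshold; afterwards the bound is reset,
  so only a power of \<open>s\<close> remains.\<close>

lemma iterated_integral_cell:
  assumes "0 \<le> s" "2 ^ length st * s \<le> u"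
    and "total_nodes rs + total_nodes st + total_nodes F = r + length st"
  shows "iterated_integral r (\<lambda>xs. if cell rs st F s u xs then 1 else 0) =
    ennreal (2 ^ (length rs choose 2) / fact (length rs) * (u - 2 ^ length st * s) ^ length rs *
      vol_const (rev rs @ st) F * s ^ (r - length rs))"
  using assms
proof (induction "2 * total_nodes rs + (\<Sum>t\<leftarrow>st. 2 * num_nodes t - 1) + 2 * total_nodes F"
    arbitrary: rs st F s u r rule: less_induct)
  case less
  show ?case
  proof (cases rs)
    case (Cons t rs')
    let ?k = "length rs'" and ?l = "2 ^ length st * s"
    have dec: "2 * total_nodes rs' + (\<Sum>t\<leftarrow>t # st. 2 * num_nodes t - 1) + 2 * total_nodes F
        < 2 * total_nodes rs + (\<Sum>t\<leftarrow>st. 2 * num_nodes t - 1) + 2 * total_nodes F"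
      using Cons num_nodes_pos[of t] by simp
    have "r \<noteq> 0"
      using less(4) Cons num_nodes_pos[of t] length_le_total_nodes[of st] by simp
    then obtain r' where r: "r = Suc r'"
      by (cases r) auto
    define C where "C = 2 ^ (?k choose 2) / fact ?k * vol_const (rev rs @ st) F * s ^ (r' - ?k)"
    have "0 \<le> C"
      using less(2) vol_const_pos[of "rev rs @ st" F] by (simp add: C_def)
    have IH: "iterated_integral r' (\<lambda>xs. if cell rs' (t # st) F s (2 * x) xs then 1 else 0) =
        ennreal (C * (2 * x - 2 * ?l) ^ ?k)" if "?l \<le> x" for x
      using less(1)[OF dec, of s "2 * x" r'] less(2,4) that
      by (simp add: Cons r C_def mult_ac)
    have "iterated_integral r (\<lambda>xs. if cell rs st F s u xs then 1 else 0) =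
      iterated_integral (Suc r') (\<lambda>xs. if ?l \<le> hd xs \<and> hd xs \<le> u \<and>
        cell rs' (t # st) F s (2 * hd xs) (tl xs) then 1 else 0)"
      by (simp add: r Cons)
    also have "\<dots> = ennreal (C * 2 ^ ?k * (u - ?l) ^ Suc ?k / Suc ?k - C * 2 ^ ?k * (?l - ?l) ^ Suc ?k / Suc ?k)"
    proof (rule iterated_integral_Cons)
      show "((\<lambda>x. C * 2 ^ ?k * (x - ?l) ^ Suc ?k / Suc ?k) has_real_derivative
          C * (2 * x - 2 * ?l) ^ ?k) (at x)" for x
      proof -
        \<comment> \<open>The push doubles the gap, so the \<open>?k\<close> remaining children
          contribute \<open>2 ^ ?k\<close>; over a family these powers add up to the exponent
          \<open>length rs choose 2\<close>.\<close>
        have "(2 * x - 2 * ?l) ^ ?k = 2 ^ ?k * (x - ?l) ^ ?k"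
          by (simp only: right_diff_distrib[symmetric] power_mult_distrib)
        then show ?thesis
          using DERIV_power_antiderivative[of "C * 2 ^ ?k" ?l ?k x] by (simp only: mult.assoc)
      qed
    qed (use less(3) IH \<open>0 \<le> C\<close> in auto)
    also have "C * 2 ^ ?k * (u - ?l) ^ Suc ?k / Suc ?k - C * 2 ^ ?k * (?l - ?l) ^ Suc ?k / Suc ?k =
      2 ^ (length rs choose 2) / fact (length rs) * (u - ?l) ^ length rs *
      vol_const (rev rs @ st) F * s ^ (r - length rs)"
      by (simp add: C_def Cons r Suc_choose_2 power_add field_simps)
    finally show ?thesis .
  next
    case rs: Nil
    show ?thesis
    proof (cases st)
      case (Cons t st')
      obtain ts where t: "t = PNode ts"
        by (cases t)
      have dec: "2 * total_nodes (rev ts) + (\<Sum>t\<leftarrow>st'. 2 * num_nodes t - 1) + 2 * total_nodes F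
          < 2 * total_nodes rs + (\<Sum>t\<leftarrow>st. 2 * num_nodes t - 1) + 2 * total_nodes F"
        using Cons rs t by (simp add: sum_list_rev flip: rev_map)
      have r: "length ts \<le> r"
        using less(4) rs Cons t length_le_total_nodes[of ts] length_le_total_nodes[of st'] by simp
      have "iterated_integral r (\<lambda>xs. if cell rs st F s u xs then 1 else 0) =
          iterated_integral r (\<lambda>xs. if cell (rev ts) st' F s (2 ^ Suc (length st') * s) xs then 1 else 0)"
        by (simp add: rs Cons t)
      also have "\<dots> = ennreal (2 ^ (length ts choose 2) / fact (length ts) *
          (2 ^ Suc (length st') * s - 2 ^ length st' * s) ^ length ts *
          vol_const (ts @ st') F * s ^ (r - length ts))"
        using less(2,4) rs Cons t
        by (subst less(1)[OF dec]) (auto simp: sum_list_rev simp flip: rev_map)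
      \<comment> \<open>After a pop the bound is twice the threshold, so the gap equals the
        threshold.\<close>
      also have "(2 ^ Suc (length st') * s - 2 ^ length st' * s) ^ length ts * s ^ (r - length ts) =
          2 ^ (length st' * length ts) * s ^ r"
        using r by (simp add: power_mult_distrib power_mult flip: power_add mult.assoc)
      then have "2 ^ (length ts choose 2) / fact (length ts) *
          (2 ^ Suc (length st') * s - 2 ^ length st' * s) ^ length ts *
          vol_const (ts @ st') F * s ^ (r - length ts) = vol_const st F * s ^ r"
        by (simp add: Cons t power_add)
      finally show ?thesis
        by (simp add: rs numeral_2_eq_2)
    next
      case st: Nil
      show ?thesis
      proof (cases F)
        case Nil
        with less(4) show ?thesis
          by (simp add: rs st numeral_2_eq_2)
      next
        case (Cons t F')
        obtain ts where t: "t = PNode ts"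
          by (cases t)
        have dec: "2 * total_nodes (rev ts) + (\<Sum>t\<leftarrow>[]. 2 * num_nodes t - 1) + 2 * total_nodes F'
            < 2 * total_nodes rs + (\<Sum>t\<leftarrow>st. 2 * num_nodes t - 1) + 2 * total_nodes F"
          using Cons rs t st by (simp add: sum_list_rev flip: rev_map)
        define r' where "r' = total_nodes (ts @ F')"
        have r: "r = Suc r'" "total_nodes F = Suc r'"
          using less(4) by (simp_all add: rs st Cons t r'_def)
        have ts: "length ts \<le> r'"
          using length_le_total_nodes[of ts] by (simp add: r'_def)
        let ?C = "vol_const [t] F'"
        \<comment> \<open>The new root \<open>x\<close> is the scale and the gap is
          \<open>2 * x - x\<close>, so the inner volume is a pure power of \<open>x\<close>, as in a
          cone.\<close>
        have IH: "iterated_integral r' (\<lambda>xs. if cell (rev ts) [] F' x (2 * x) xs then 1 else 0) =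
            ennreal (?C * x ^ r')" if "0 \<le> x" for x
        proof -
          have "x ^ length ts * x ^ (r' - length ts) = x ^ r'"
            using ts by (simp flip: power_add)
          then show ?thesis
            using that
            by (subst less(1)[OF dec])
              (auto simp: r'_def t sum_list_rev mult.assoc mult.left_commute[of _ "vol_const ts F'"]
                simp flip: rev_map)
        qed
        have "iterated_integral r (\<lambda>xs. if cell rs st F s u xs then 1 else 0) =
          iterated_integral (Suc r') (\<lambda>xs. if 0 \<le> hd xs \<and> hd xs \<le> s \<and>
            cell (rev ts) [] F' (hd xs) (2 * hd xs) (tl xs) then 1 else 0)"
          by (simp add: rs st r Cons t)
        also have "\<dots> = ennreal (?C * s ^ Suc r' / Suc r' - ?C * 0 ^ Suc r' / Suc r')"
        proof (rule iterated_integral_Cons)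
          show "((\<lambda>x. ?C * x ^ Suc r' / Suc r') has_real_derivative ?C * x ^ r') (at x)" for x
            using DERIV_power_antiderivative[of ?C 0 r' x] by (simp only: diff_zero)
        qed (use less(2) IH vol_const_pos[of "[t]" F'] in auto)
        also have "?C * s ^ Suc r' / Suc r' - ?C * 0 ^ Suc r' / Suc r' = vol_const [] F * s ^ r"
          using r by (simp add: Cons)
        finally show ?thesis
          by (simp add: rs st numeral_2_eq_2)
      qed
    qed
  qed
qed

lemma iterated_integral_chain:
  "0 \<le> u \<Longrightarrow> iterated_integral n (\<lambda>xs. if chain 0 u xs then 1 else 0) =
    ennreal (2 ^ (n choose 2) / fact n * u ^ n)"
proof (induction n arbitrary: u)
  case (Suc n)
  let ?C = "2 ^ (n choose 2) / fact n * 2 ^ n :: real"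
  have "iterated_integral (Suc n) (\<lambda>xs. if chain 0 u xs then 1 else 0) =
      iterated_integral (Suc n) (\<lambda>xs. if 0 \<le> hd xs \<and> hd xs \<le> u \<and> chain 0 (2 * hd xs) (tl xs) then 1 else 0)"
    by simp
  also have "\<dots> = ennreal (?C * u ^ Suc n / Suc n - ?C * 0 ^ Suc n / Suc n)"
  proof (rule iterated_integral_Cons)
    show "((\<lambda>x. ?C * x ^ Suc n / Suc n) has_real_derivative ?C * x ^ n) (at x)" for x
      using DERIV_power_antiderivative[of ?C 0 n x] by (simp only: diff_zero)
    show "iterated_integral n (\<lambda>xs. if chain 0 (2 * x) xs then 1 else 0) = ennreal (?C * x ^ n)"
      if "0 \<le> x" for x
      using Suc.IH[of "2 * x"] that by (simp add: power_mult_distrib)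
  qed (use Suc.prems in auto)
  also have "?C * u ^ Suc n / Suc n - ?C * 0 ^ Suc n / Suc n =
      2 ^ (Suc n choose 2) / fact (Suc n) * u ^ Suc n"
    by (simp add: Suc_choose_2 power_add field_simps)
  finally show ?case .
qed (simp add: numeral_2_eq_2)

lemma measure_lebesgue_polytope:
  "polytope S \<Longrightarrow> emeasure lborel S = ennreal v \<Longrightarrow> 0 \<le> v \<Longrightarrow> measure lebesgue S = v"
  by (simp add: measure_def borel_compact polytope_imp_compact)

context
  fixes e :: "nat \<Rightarrow> 'n::finite"
  assumes e: "bij_betw e {1..CARD('n)} UNIV"
begin

lemma measure_D_forest:
  assumes "t # F \<in> plane_forests (CARD('n) + 1)"
  shows "measure lebesgue (D_forest e (t # F)) = vol_const [t] F"
proof (rule measure_lebesgue_polytope)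
  show poly: "polytope (D_forest e (t # F))"
    by (rule polytope_D_forest[OF e])
  then have "{x. cell [] [t] F 1 2 (coord_list e x)} \<in> sets borel"
    unfolding D_forest_cell[of e t F 2] by (intro borel_compact polytope_imp_compact)
  with emeasure_coord_list[OF e this] show "emeasure lborel (D_forest e (t # F)) = ennreal (vol_const [t] F)"
    using iterated_integral_cell[of 1 "[t]" 2 "[]" F "CARD('n)"] assms
    by (simp add: D_forest_cell[of e t F 2] plane_forests_def numeral_2_eq_2)
qed (use vol_const_pos[of "[t]" F] in simp)

lemma measure_Gayley: "fact CARD('n) * measure lebesgue (Gayley e) = 2 ^ (CARD('n) + 1 choose 2)"
proof -
  have "measure lebesgue (Gayley e) = 2 ^ (CARD('n) choose 2) / fact CARD('n) * 2 ^ CARD('n)"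
  proof (rule measure_lebesgue_polytope)
    show "polytope (Gayley e)"
      by (rule polytope_Gayley[OF e])
    then have "{x. chain 0 2 (coord_list e x)} \<in> sets borel"
      unfolding Gayley_chain by (intro borel_compact polytope_imp_compact)
    from emeasure_coord_list[OF e this]
    show "emeasure lborel (Gayley e) = ennreal (2 ^ (CARD('n) choose 2) / fact CARD('n) * 2 ^ CARD('n))"
      by (simp add: Gayley_chain iterated_integral_chain)
  qed simp
  then show ?thesis
    by (simp add: Suc_choose_2 power_add)
qed

end

subsection \<open>Search forests of labeled graphs\<close>

text \<open>The search returning trees instead of edges: those at the waiting nodes, in stack order,
  and those of the later components. The neighbours of \<open>v\<close> are pushed on top, so theirs
  are the first \<open>length nbs\<close> trees; the stack \<open>[u]\<close> returns exactly one
  tree, hence \<open>hd\<close>.\<close>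

function search_forest :: "nat set set \<Rightarrow> nat list \<Rightarrow> nat list \<Rightarrow> plane_tree list \<times> plane_forest" where
  "search_forest E [] [] = ([], [])"
| "search_forest E (u # us) [] = (let (ts, F) = search_forest E us [u] in ([], hd ts # F))"
| "search_forest E us (v # vs) =
     (let nbs = filter (\<lambda>u. {v, u} \<in> E) us;
          (ts, F) = search_forest E (filter (\<lambda>u. {v, u} \<notin> E) us) (rev nbs @ vs)
      in (PNode (take (length nbs) ts) # drop (length nbs) ts, F))"
  by pat_completeness auto
termination
proof (relation "Wellfounded.measure (\<lambda>(E, us, st). 2 * length us + length st)")
  fix E :: "nat set set" and us nbs st :: "nat list" and v :: nat
  assume "nbs = filter (\<lambda>u. {v, u} \<in> E) us"
  then have "length nbs + length (filter (\<lambda>u. {v, u} \<notin> E) us) = length us"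
    by (simp add: sum_length_filter_compl)
  then show "((E, filter (\<lambda>u. {v, u} \<notin> E) us, rev nbs @ st), (E, us, v # st))
      \<in> Wellfounded.measure (\<lambda>(E, us, st). 2 * length us + length st)"
    by simp
qed simp_all

lemma length_search_forest: "length (fst (search_forest E us vs)) = length vs"
  by (induction E us vs rule: search_forest.induct) (auto simp: Let_def split: prod.splits)

lemma search_forest_new_component:
  "search_forest E (u # us) [] = ([], t # F) \<longleftrightarrow> search_forest E us [u] = ([t], F)"
  using length_search_forest[of E us "[u]"]
  by (cases "search_forest E us [u]") (auto simp: length_Suc_conv)

lemma search_forest_active:
  "search_forest E us (v # vs) = (PNode ts # st, F) \<longleftrightarrow>
     length (filter (\<lambda>u. {v, u} \<in> E) us) = length ts \<and>
     search_forest E (filter (\<lambda>u. {v, u} \<notin> E) us) (rev (filter (\<lambda>u. {v, u} \<in> E) us) @ vs) =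
       (ts @ st, F)"
proof -
  let ?nbs = "filter (\<lambda>u. {v, u} \<in> E) us"
  obtain ts' F' where eq: "search_forest E (filter (\<lambda>u. {v, u} \<notin> E) us) (rev ?nbs @ vs) = (ts', F')"
    by (cases "search_forest E (filter (\<lambda>u. {v, u} \<notin> E) us) (rev ?nbs @ vs)")
  then have "length ts' = length ?nbs + length vs"
    using length_search_forest[of E "filter (\<lambda>u. {v, u} \<notin> E) us" "rev ?nbs @ vs"] by simp
  with eq show ?thesis
    by (auto simp: Let_def)
qed

text \<open>The search inspects only pairs of distinct nodes from \<open>us @ vs\<close>. This
  permits deleting the edges of a node once it has been active.\<close>

lemma search_forest_cong:
  assumes "distinct (us @ vs)"
    and "\<And>a b. a \<in> set (us @ vs) \<Longrightarrow> b \<in> set (us @ vs) \<Longrightarrow> a \<noteq> b \<Longrightarrow> {a, b} \<in> E \<longleftrightarrow> {a, b} \<in> E'"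
  shows "search_forest E us vs = search_forest E' us vs"
  using assms
proof (induction E us vs rule: search_forest.induct)
  case (2 E u us)
  then show ?case by simp
next
  case (3 E us v vs)
  have "{v, u} \<in> E \<longleftrightarrow> {v, u} \<in> E'" if "u \<in> set us" for u
    using that "3.prems"(1) by (intro "3.prems"(2)) auto
  then have nbs: "filter (\<lambda>u. {v, u} \<in> E') us = filter (\<lambda>u. {v, u} \<in> E) us"
    "filter (\<lambda>u. {v, u} \<notin> E') us = filter (\<lambda>u. {v, u} \<notin> E) us"
    by (auto intro!: filter_cong)
  have "search_forest E (filter (\<lambda>u. {v, u} \<notin> E) us) (rev (filter (\<lambda>u. {v, u} \<in> E) us) @ vs) =
      search_forest E' (filter (\<lambda>u. {v, u} \<notin> E) us) (rev (filter (\<lambda>u. {v, u} \<in> E) us) @ vs)"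
  proof (rule "3.IH"[OF refl])
    show "distinct (filter (\<lambda>u. {v, u} \<notin> E) us @ rev (filter (\<lambda>u. {v, u} \<in> E) us) @ vs)"
      using "3.prems"(1) by auto
  qed (use "3.prems"(2) in auto)
  then show ?case
    by (simp add: nbs)
qed simp

text \<open>\<open>X\<close> is closed under adjacency in both ambient sets, so neither recursion
  leaves it. Removing \<open>v\<close> from all three sets keeps the closure and drives the
  induction.\<close>

lemma plane_tree_at_cong:
  assumes "finite W" "finite W'" "X \<subseteq> W" "X \<subseteq> W'" "v \<in> X"
    and "\<And>a b. a \<in> X \<Longrightarrow> b \<in> W \<Longrightarrow> {a, b} \<in> S \<Longrightarrow> b \<in> X"
    and "\<And>a b. a \<in> X \<Longrightarrow> b \<in> W' \<Longrightarrow> {a, b} \<in> S' \<Longrightarrow> b \<in> X"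
    and "\<And>a b. a \<in> X \<Longrightarrow> b \<in> X \<Longrightarrow> {a, b} \<in> S \<longleftrightarrow> {a, b} \<in> S'"
  shows "plane_tree_at S W v = plane_tree_at S' W' v"
  using assms
proof (induction "card X" arbitrary: X W W' v rule: less_induct)
  case less
  have X: "finite X"
    using less.prems(1,3) finite_subset by blast
  have nbs: "{u \<in> W - {v}. {v, u} \<in> S} = {u \<in> W' - {v}. {v, u} \<in> S'}"
    using less.prems(3-8) by blast
  have "plane_tree_at S (W - {v}) u = plane_tree_at S' (W' - {v}) u"
    if "u \<in> {u \<in> W - {v}. {v, u} \<in> S}" for u
  proof (rule less.hyps[of "X - {v}"])
    show "card (X - {v}) < card X"
      using X less.prems(5) by (rule card_Diff1_less)
    show "u \<in> X - {v}"
      using that less.prems(5,6) by blast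
  qed (use less.prems in blast)+
  then have "map (plane_tree_at S (W - {v})) (sorted_list_of_set {u \<in> W - {v}. {v, u} \<in> S}) =
      map (plane_tree_at S' (W' - {v})) (sorted_list_of_set {u \<in> W - {v}. {v, u} \<in> S})"
    using less.prems(1) by (intro map_cong refl) simp
  then show ?case
    using less.prems(1-5) nbs plane_tree_at.simps[of S W v] plane_tree_at.simps[of S' W' v]
    by (auto simp del: map_eq_conv)
qed

text \<open>\<open>f\<close> sends each node to the root of its component in \<open>S\<close>: a
  waiting node or the root of a later component. Constancy along edges separates the components, and
  reachability shows that they are not split further. Maximality is claimed for later roots only,
  since a waiting node may be smaller than its descendants.\<close>

lemma search_edges_forest:
  fixes E :: "nat set set" and us vs :: "nat list"
  assumes "distinct (us @ vs)" "sorted_wrt (>) us"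
  defines "S \<equiv> search_edges E us vs" and "V \<equiv> set us \<union> set vs"
  shows "\<exists>roots f. map (plane_tree_at S V) vs = fst (search_forest E us vs) \<and>
    map (plane_tree_at S V) roots = snd (search_forest E us vs) \<and>
    sorted_wrt (>) roots \<and> set roots \<subseteq> set us \<and>
    (\<forall>a b. {a, b} \<in> S \<longrightarrow> a \<in> V \<and> b \<in> V \<and> f a = f b) \<and>
    (\<forall>w\<in>set vs \<union> set roots. f w = w) \<and>
    (\<forall>a\<in>V. f a \<in> set vs \<union> set roots \<and> (a, f a) \<in> {(a, b). {a, b} \<in> S}\<^sup>* \<and>
      (f a \<in> set roots \<longrightarrow> a \<le> f a))"
  using assms(1,2) unfolding S_def V_def
proof (induction E us vs rule: search_edges.induct)
  case (1 E)
  then show ?case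
    by simp
next
  case (2 E u us)
  let ?S = "search_edges E us [u]" and ?V = "set us \<union> set [u]"
  obtain roots f where IH: "map (plane_tree_at ?S ?V) [u] = fst (search_forest E us [u])"
    "map (plane_tree_at ?S ?V) roots = snd (search_forest E us [u])"
    "sorted_wrt (>) roots" "set roots \<subseteq> set us"
    "\<forall>a b. {a, b} \<in> ?S \<longrightarrow> a \<in> ?V \<and> b \<in> ?V \<and> f a = f b"
    "\<forall>w\<in>set [u] \<union> set roots. f w = w"
    "\<forall>a\<in>?V. f a \<in> set [u] \<union> set roots \<and> (a, f a) \<in> {(a, b). {a, b} \<in> ?S}\<^sup>* \<and>
      (f a \<in> set roots \<longrightarrow> a \<le> f a)"
    using 2 by auto
  have sf: "search_forest E (u # us) [] = ([], map (plane_tree_at ?S ?V) (u # roots))"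
    using IH(1,2) by (cases "search_forest E us [u]") auto
  have V: "set (u # us) \<union> set [] = ?V"
    by auto
  have S: "search_edges E (u # us) [] = ?S"
    by simp
  \<comment> \<open>\<open>us\<close> is decreasing, so the root of the new component is its
    maximum.\<close>
  have le: "a \<le> u" if "a \<in> ?V" for a
    using that "2.prems"(2) by auto
  show ?case
    unfolding S V sf
  proof (intro exI conjI)
    show "sorted_wrt (>) (u # roots)"
      using IH(3,4) "2.prems"(2) by auto
    show "\<forall>a b. {a, b} \<in> ?S \<longrightarrow> a \<in> ?V \<and> b \<in> ?V \<and> f a = f b"
      by (rule IH(5))
    show "\<forall>w\<in>set [] \<union> set (u # roots). f w = w"
      using IH(6) by simp
    show "\<forall>a\<in>?V. f a \<in> set [] \<union> set (u # roots) \<and> (a, f a) \<in> {(a, b). {a, b} \<in> ?S}\<^sup>* \<and>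
        (f a \<in> set (u # roots) \<longrightarrow> a \<le> f a)"
      using IH(7) le by fastforce
    show "set (u # roots) \<subseteq> set (u # us)"
      using IH(4) by auto
  qed auto
next
  case (3 E us v vs)
  define nbs where "nbs = filter (\<lambda>u. {v, u} \<in> E) us"
  define us' where "us' = filter (\<lambda>u. {v, u} \<notin> E) us"
  define S' where "S' = search_edges E us' (rev nbs @ vs)"
  define V' where "V' = set us' \<union> set (rev nbs @ vs)"
  define V where "V = set us \<union> set (v # vs)"
  define S where "S = (\<lambda>u. {v, u}) ` set nbs \<union> S'"
  have us: "set us = set us' \<union> set nbs" "set us' \<inter> set nbs = {}"
    by (auto simp: us'_def nbs_def)
  have distinct: "distinct (us' @ rev nbs @ vs)"
    using "3.prems"(1) by (auto simp: us'_def nbs_def)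
  have sorted: "sorted_wrt (>) us'"
    using "3.prems"(2) by (simp add: us'_def sorted_wrt_filter)
  obtain roots f where IH: "map (plane_tree_at S' V') (rev nbs @ vs) = fst (search_forest E us' (rev nbs @ vs))"
    "map (plane_tree_at S' V') roots = snd (search_forest E us' (rev nbs @ vs))"
    "sorted_wrt (>) roots" "set roots \<subseteq> set us'"
    and f: "\<forall>a b. {a, b} \<in> S' \<longrightarrow> a \<in> V' \<and> b \<in> V' \<and> f a = f b"
    "\<forall>w\<in>set (rev nbs @ vs) \<union> set roots. f w = w"
    "\<forall>a\<in>V'. f a \<in> set (rev nbs @ vs) \<union> set roots \<and> (a, f a) \<in> {(a, b). {a, b} \<in> S'}\<^sup>* \<and>
      (f a \<in> set roots \<longrightarrow> a \<le> f a)"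
    using "3.IH"[OF nbs_def, folded us'_def, OF distinct sorted, folded S'_def V'_def]
    by (elim exE conjE) (rule that)
  note IH5 = f(1)[rule_format] and IH6 = f(2)[rule_format] and IH7 = f(3)[rule_format]
  have V: "V = insert v V'" "v \<notin> V'"
    using us "3.prems"(1) by (auto simp: V_def V'_def us'_def nbs_def)
  have finite: "finite V" "finite V'"
    by (auto simp: V_def V'_def)
  have S_S': "{a, b} \<in> S \<longleftrightarrow> {a, b} \<in> S'" if "a \<in> V'" "b \<in> V'" for a b
    using that V by (auto simp: S_def doubleton_eq_iff)
  have S_v: "{v, u} \<in> S \<longleftrightarrow> u \<in> set nbs" for u
    using V(2) IH5 by (auto simp: S_def doubleton_eq_iff)
  \<comment> \<open>Activating \<open>v\<close> merges the components of its new neighbours under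
    \<open>v\<close>.\<close>
  define g where "g a = (if a = v \<or> f a \<in> set nbs then v else f a)" for a
  have child: "plane_tree_at S V' u = plane_tree_at S' V' u" if "u \<in> V'" for u
    by (rule plane_tree_at_cong[of _ _ V']) (use that finite S_S' in auto)
  \<comment> \<open>The fibre of \<open>f\<close> over \<open>w\<close> is the component of
    \<open>w\<close>; the new edges only join \<open>v\<close> to fibres over new
    neighbours.\<close>
  have other: "plane_tree_at S V w = plane_tree_at S' V' w" if w: "w \<in> set vs \<union> set roots" for w
  proof (rule plane_tree_at_cong[of _ _ "{a \<in> V'. f a = w}"])
    have nw: "w \<notin> set nbs"
      using w distinct IH(4) us(2) by auto
    show "w \<in> {a \<in> V'. f a = w}"
      using w IH(4) IH6 by (auto simp: V'_def)
    show "b \<in> {a \<in> V'. f a = w}" if "a \<in> {a \<in> V'. f a = w}" "b \<in> V" "{a, b} \<in> S" for a b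
    proof (cases "b = v")
      case True
      then have "a \<in> set nbs"
        using that(3) S_v by (simp add: insert_commute)
      with IH6[of a] that(1) nw show ?thesis
        by simp
    next
      case False
      then show ?thesis
        using that V S_S'[of a b] IH5[of a b] by auto
    qed
    show "b \<in> {a \<in> V'. f a = w}" if "a \<in> {a \<in> V'. f a = w}" "b \<in> V'" "{a, b} \<in> S'" for a b
      using that IH5[of a b] by auto
  qed (use finite V S_S' in auto)
  have "plane_tree_at S V v = PNode (map (plane_tree_at S' V') (rev nbs))"
  proof -
    have "{u \<in> V - {v}. {v, u} \<in> S} = set (rev nbs)"
      using V S_v by (auto simp: V'_def)
    moreover have "sorted_wrt (<) (rev nbs)"
      using "3.prems"(2) by (simp add: nbs_def sorted_wrt_rev sorted_wrt_filter)
    then have "sorted (rev nbs)" "distinct (rev nbs)"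
      unfolding strict_sorted_iff by auto
    ultimately have "sorted_list_of_set {u \<in> V - {v}. {v, u} \<in> S} = rev nbs"
      by (simp only: sorted_list_of_set.idem_if_sorted_distinct)
    moreover have "V - {v} = V'"
      using V by auto
    moreover have "map (plane_tree_at S V') (rev nbs) = map (plane_tree_at S' V') (rev nbs)"
      by (intro map_cong refl child) (auto simp: V'_def)
    ultimately show ?thesis
      using plane_tree_at.simps[of S V v] finite V by (simp del: map_eq_conv)
  qed
  moreover have "map (plane_tree_at S V) vs = map (plane_tree_at S' V') vs"
    "map (plane_tree_at S V) roots = map (plane_tree_at S' V') roots"
    using other by auto
  moreover have "search_forest E us (v # vs) =
      (PNode (map (plane_tree_at S' V') (rev nbs)) # map (plane_tree_at S' V') vs,
       map (plane_tree_at S' V') roots)"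
    unfolding search_forest_active using IH(1,2)
    by (cases "search_forest E us' (rev nbs @ vs)") (auto simp: us'_def nbs_def)
  ultimately have sf: "search_forest E us (v # vs) =
      (map (plane_tree_at S V) (v # vs), map (plane_tree_at S V) roots)"
    by simp
  have S: "search_edges E us (v # vs) = S"
    by (simp add: S_def S'_def nbs_def us'_def Let_def)
  have roots: "w \<notin> set nbs" if "w \<in> set roots" for w
    using that IH(4) us(2) by auto
  show ?case
    unfolding S V_def[symmetric] sf
  proof (intro exI[of _ roots] exI[of _ g] conjI allI ballI impI)
    show "set roots \<subseteq> set us"
      using IH(4) us by auto
    show "a \<in> V" "b \<in> V" "g a = g b" if "{a, b} \<in> S" for a b
    proof -
      have "a \<in> V \<and> b \<in> V \<and> g a = g b"
      proof (cases "{a, b} \<in> S'")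
        case True
        then show ?thesis
          using IH5[of a b] V by (auto simp: g_def)
      next
        case False
        then obtain u where u: "u \<in> set nbs" "a = v \<and> b = u \<or> a = u \<and> b = v"
          using \<open>{a, b} \<in> S\<close> by (auto simp: S_def doubleton_eq_iff)
        moreover have "u \<in> V'"
          using u by (auto simp: V'_def)
        ultimately show ?thesis
          using IH6[of u] V by (auto simp: g_def)
      qed
      then show "a \<in> V" "b \<in> V" "g a = g b"
        by auto
    qed
    show "g w = w" if "w \<in> set (v # vs) \<union> set roots" for w
      using that IH6[of w] roots distinct by (auto simp: g_def)
    have sub: "{(a, b). {a, b} \<in> S'}\<^sup>* \<subseteq> {(a, b). {a, b} \<in> S}\<^sup>*"
      by (intro rtrancl_mono) (auto simp: S_def)
    fix a
    assume "a \<in> V"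
    show "g a \<in> set (v # vs) \<union> set roots"
      using \<open>a \<in> V\<close> V IH7[of a] by (auto simp: g_def)
    show "a \<le> g a" if "g a \<in> set roots"
    proof -
      have "v \<notin> set roots"
        using V IH(4) by (auto simp: V'_def)
      with that \<open>a \<in> V\<close> V IH7[of a] show ?thesis
        by (auto simp: g_def split: if_splits)
    qed
    show "(a, g a) \<in> {(a, b). {a, b} \<in> S}\<^sup>*"
    proof (cases "a = v")
      case False
      then have *: "(a, f a) \<in> {(a, b). {a, b} \<in> S}\<^sup>*"
        using \<open>a \<in> V\<close> V IH7[of a] sub by auto
      show ?thesis
      proof (cases "f a \<in> set nbs")
        case True
        then have "(f a, v) \<in> {(a, b). {a, b} \<in> S}"
          using S_v[of "f a"] by (simp add: insert_commute[of v])
        with * have "(a, v) \<in> {(a, b). {a, b} \<in> S}\<^sup>*"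
          by (rule rtrancl_into_rtrancl)
        with True show ?thesis
          by (simp add: g_def)
      qed (use * False in \<open>simp add: g_def\<close>)
    qed (simp add: g_def)
  qed (use IH(3) in auto)
qed

text \<open>The fibres of \<open>f\<close> are the components of the search forest, and
  \<open>f\<close> picks the maximum of each, so \<open>roots\<close> lists
  \<open>component_roots\<close> in decreasing order.\<close>

lemma Psi_search_forest: "Psi N E = snd (search_forest E (rev [1..<N+1]) [])"
proof -
  let ?us = "rev [1..<N+1]"
  define S where "S = search_edges E ?us []"
  define V where "V = {1..N}"
  have us: "set ?us \<union> set [] = V"
    by (auto simp: V_def)
  have "distinct (?us @ [])" "sorted_wrt (>) ?us"
    by (auto simp: sorted_wrt_rev simp del: upt_Suc)
  from search_edges_forest[OF this, of E, folded S_def, unfolded us]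
  obtain roots f where R: "map (plane_tree_at S V) roots = snd (search_forest E ?us [])"
    "sorted_wrt (>) roots" "set roots \<subseteq> set ?us"
    and f: "\<forall>a b. {a, b} \<in> S \<longrightarrow> a \<in> V \<and> b \<in> V \<and> f a = f b"
    "\<forall>w\<in>set [] \<union> set roots. f w = w"
    "\<forall>a\<in>V. f a \<in> set [] \<union> set roots \<and> (a, f a) \<in> {(a, b). {a, b} \<in> S}\<^sup>* \<and>
      (f a \<in> set roots \<longrightarrow> a \<le> f a)"
    by (elim exE conjE) (rule that)
  have R4: "f a = f b" if "{a, b} \<in> S" for a b
    using f(1) that by blast
  have R5: "f w = w" if "w \<in> set roots" for w
    using f(2) that by blast
  have R6: "f a \<in> set roots \<and> (a, f a) \<in> {(a, b). {a, b} \<in> S}\<^sup>* \<and> a \<le> f a" if "a \<in> V" for a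
    using f(3) that by auto
  have roots: "set roots \<subseteq> V"
    using R(3) us by auto
  have reach: "f a = f b" if "(a, b) \<in> {(a, b). {a, b} \<in> S}\<^sup>*" for a b
    using that by (induction rule: rtrancl_induct) (auto dest: R4)
  have "component_roots N S = set roots"
  proof
    show "component_roots N S \<subseteq> set roots"
    proof
      fix v
      assume v: "v \<in> component_roots N S"
      then have "v \<in> V"
        by (simp add: component_roots_def V_def)
      from R6[OF this] roots have "f v \<in> V" "(v, f v) \<in> {(a, b). {a, b} \<in> S}\<^sup>*"
        by auto
      with v have "f v \<le> v"
        by (auto simp: component_roots_def V_def)
      with R6[OF \<open>v \<in> V\<close>] show "v \<in> set roots"
        by auto
    qed
    show "set roots \<subseteq> component_roots N S"
    proof
      fix v
      assume v: "v \<in> set roots"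
      have "u \<le> v" if "u \<in> V" "(v, u) \<in> {(a, b). {a, b} \<in> S}\<^sup>*" for u
        using reach[OF that(2)] R5[OF v] R6[OF that(1)] by simp
      with v roots show "v \<in> component_roots N S"
        by (auto simp: component_roots_def V_def)
    qed
  qed
  moreover have "sorted_wrt (<) (rev roots)"
    using R(2) by (simp add: sorted_wrt_rev)
  then have "sorted (rev roots)" "distinct (rev roots)"
    unfolding strict_sorted_iff by auto
  ultimately have "rev (sorted_list_of_set (component_roots N S)) = roots"
    by (metis rev_rev_ident set_rev sorted_list_of_set.idem_if_sorted_distinct)
  then show ?thesis
    using R(1) by (simp add: Psi_def underlying_plane_forest_def nfs_forest_def S_def V_def)
qed

subsection \<open>Counting graphs\<close>

abbreviation pairs :: "nat set \<Rightarrow> nat set set" where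
  "pairs V \<equiv> {p. p \<subseteq> V \<and> card p = 2}"

text \<open>For the neighbourhood of the active node: \<open>U\<close> are the unvisited nodes, of
  which \<open>k\<close> become children, and \<open>W\<close> the waiting nodes, which are joined
  freely.\<close>

lemma card_subsets_Int:
  assumes "finite U" "finite W" "U \<inter> W = {}"
  shows "card {A. A \<subseteq> U \<union> W \<and> card (A \<inter> U) = k} = (card U choose k) * 2 ^ card W"
proof -
  have "bij_betw (\<lambda>(B, C). B \<union> C) ({B. B \<subseteq> U \<and> card B = k} \<times> Pow W)
      {A. A \<subseteq> U \<union> W \<and> card (A \<inter> U) = k}"
  proof (rule bij_betw_byWitness[where f' = "\<lambda>A. (A \<inter> U, A \<inter> W)"])
    show "\<forall>a\<in>{B. B \<subseteq> U \<and> card B = k} \<times> Pow W.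
        (\<lambda>A. (A \<inter> U, A \<inter> W)) ((\<lambda>(B, C). B \<union> C) a) = a"
      using assms(3) by fastforce
    show "(\<lambda>(B, C). B \<union> C) ` ({B. B \<subseteq> U \<and> card B = k} \<times> Pow W)
        \<subseteq> {A. A \<subseteq> U \<union> W \<and> card (A \<inter> U) = k}"
    proof clarsimp
      fix B C
      assume "B \<subseteq> U" "C \<subseteq> W"
      then have "(B \<union> C) \<inter> U = B"
        using assms(3) by blast
      then show "B \<subseteq> U \<union> W \<and> C \<subseteq> U \<union> W \<and> card ((B \<union> C) \<inter> U) = card B"
        using \<open>B \<subseteq> U\<close> \<open>C \<subseteq> W\<close> by auto
    qed
  qed auto
  then have "card {A. A \<subseteq> U \<union> W \<and> card (A \<inter> U) = k} = card ({B. B \<subseteq> U \<and> card B = k} \<times> Pow W)"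
    by (simp add: bij_betw_same_card)
  then show ?thesis
    using assms by (simp add: card_cartesian_product n_subsets card_Pow)
qed

text \<open>A graph corresponds to the neighbourhood \<open>A\<close> of \<open>v\<close> together
  with the graph left after deleting \<open>v\<close>; once active, \<open>v\<close> is not looked
  at again.\<close>

lemma card_search_forest_step:
  assumes "distinct (us @ v # vs)"
  shows "card {E. E \<subseteq> pairs (set us \<union> set (v # vs)) \<and> search_forest E us (v # vs) = (PNode ts # st, F)} =
    (\<Sum>A | A \<subseteq> set us \<union> set vs \<and> card (A \<inter> set us) = length ts.
       card {E. E \<subseteq> pairs (set us \<union> set vs) \<and>
         search_forest E (filter (\<lambda>u. u \<notin> A) us) (rev (filter (\<lambda>u. u \<in> A) us) @ vs) = (ts @ st, F)})"
    (is "card ?L = (\<Sum>A | ?P A. card (?M A))")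
proof -
  let ?V = "set us \<union> set vs"
  have v: "v \<notin> ?V"
    using assms by auto
  define join where "join = (\<lambda>(A, E). (\<lambda>w. {v, w}) ` A \<union> E :: nat set set)"
  define split where "split E = ({w. {v, w} \<in> E}, {p \<in> E. v \<notin> p})" for E :: "nat set set"
  have match: "search_forest E us (v # vs) = (PNode ts # st, F) \<longleftrightarrow>
      card (A \<inter> set us) = length ts \<and>
      search_forest E' (filter (\<lambda>u. u \<notin> A) us) (rev (filter (\<lambda>u. u \<in> A) us) @ vs) = (ts @ st, F)"
    if A: "A = {w. {v, w} \<in> E}" and E': "E' = {p \<in> E. v \<notin> p}" for A E E'
  proof -
    have "search_forest E (filter (\<lambda>u. u \<notin> A) us) (rev (filter (\<lambda>u. u \<in> A) us) @ vs) =
        search_forest E' (filter (\<lambda>u. u \<notin> A) us) (rev (filter (\<lambda>u. u \<in> A) us) @ vs)"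
      by (rule search_forest_cong) (use assms E' in auto)
    moreover have "card (A \<inter> set us) = length (filter (\<lambda>u. {v, u} \<in> E) us)"
      using assms A by (simp add: distinct_length_filter Int_commute)
    ultimately show ?thesis
      unfolding search_forest_active by (simp add: A)
  qed
  have "bij_betw join (SIGMA A:{A. ?P A}. ?M A) ?L"
  proof (rule bij_betw_byWitness[where f' = split])
    have split_join: "split (join (A, E)) = (A, E)" if "A \<subseteq> ?V" "E \<subseteq> pairs ?V" for A E
    proof -
      have "{v, w} \<notin> E" for w
        using that v by auto
      moreover have "v \<notin> p" if "p \<in> E" for p
        using that \<open>E \<subseteq> pairs ?V\<close> v by auto
      ultimately show ?thesis
        using that(1) v by (auto simp: split_def join_def doubleton_eq_iff)
    qed
    then show "\<forall>a\<in>SIGMA A:{A. ?P A}. ?M A. split (join a) = a"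
      by auto
    show "join ` (SIGMA A:{A. ?P A}. ?M A) \<subseteq> ?L"
    proof
      fix G
      assume "G \<in> join ` (SIGMA A:{A. ?P A}. ?M A)"
      then obtain A E where G: "G = join (A, E)"
        and A: "A \<subseteq> ?V" "card (A \<inter> set us) = length ts" and E: "E \<subseteq> pairs ?V"
        and sf: "search_forest E (filter (\<lambda>u. u \<notin> A) us) (rev (filter (\<lambda>u. u \<in> A) us) @ vs) = (ts @ st, F)"
        by auto
      have "join (A, E) \<subseteq> pairs (insert v ?V)"
        using A(1) E v by (auto simp: join_def card_insert_if)
      moreover have "search_forest (join (A, E)) us (v # vs) = (PNode ts # st, F)"
        using split_join[OF A(1) E] sf A(2) by (subst match) (auto simp: split_def)
      ultimately show "G \<in> ?L"
        by (simp add: G)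
    qed
    have *: "join (split E) = E \<and> split E \<in> (SIGMA A:{A. ?P A}. ?M A)" if "E \<in> ?L" for E
    proof
      have E: "E \<subseteq> pairs (insert v ?V)" "search_forest E us (v # vs) = (PNode ts # st, F)"
        using that by auto
      have "p \<in> (\<lambda>w. {v, w}) ` {w. {v, w} \<in> E}" if "p \<in> E" "v \<in> p" for p
      proof -
        have "card p = 2"
          using that E(1) by auto
        with that(2) obtain w where "p = {v, w}"
          by (auto simp: card_2_iff)
        with that(1) show ?thesis
          by auto
      qed
      then show "join (split E) = E"
        by (auto simp: join_def split_def)
      have "w \<in> ?V" if "{v, w} \<in> E" for w
      proof -
        have "{v, w} \<subseteq> insert v ?V" "card {v, w} = 2"
          using that E(1) by auto
        then show ?thesis
          by (cases "v = w") auto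
      qed
      then show "split E \<in> (SIGMA A:{A. ?P A}. ?M A)"
        using E(1) E(2)[unfolded match[OF refl refl]] by (auto simp: split_def)
    qed
    show "\<forall>E\<in>?L. join (split E) = E"
      by (rule ballI) (rule *[THEN conjunct1])
    show "split ` ?L \<subseteq> (SIGMA A:{A. ?P A}. ?M A)"
      by (rule image_subsetI) (rule *[THEN conjunct2])
  qed
  then have "card ?L = card (SIGMA A:{A. ?P A}. ?M A)"
    by (simp add: bij_betw_same_card)
  also have "\<dots> = (\<Sum>A | ?P A. card (?M A))"
    by (intro card_SigmaI ballI) (auto intro: finite_subset[of _ "Pow (pairs ?V)"] finite_subset[of _ "Pow ?V"])
  finally show ?thesis .
qed

lemma choose_2_add: "(a + b) choose 2 = (a choose 2) + (b choose 2) + a * b"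
  by (induction b) (simp_all add: Suc_choose_2 numeral_2_eq_2)

lemma card_search_forest:
  assumes "distinct (us @ vs)" "length vs = length st"
    "total_nodes st + total_nodes F = length us + length vs"
  shows "real (card {E. E \<subseteq> pairs (set us \<union> set vs) \<and> search_forest E us vs = (st, F)}) =
    fact (length us) * vol_const st F * 2 ^ (length st choose 2)"
  using assms
proof (induction st F arbitrary: us vs rule: vol_const.induct)
  case 1
  then have "{E. E \<subseteq> pairs (set us \<union> set vs) \<and> search_forest E us vs = ([], [])} = {{}}"
    by auto
  with 1 show ?case
    by (simp add: numeral_2_eq_2)
next
  case (2 t F)
  then have vs: "vs = []" and us_len: "length us = total_nodes (t # F)"
    by simp_all
  then obtain u us' where us: "us = u # us'"
    using num_nodes_pos[of t] by (cases us) auto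
  have "{E. E \<subseteq> pairs (set us \<union> set vs) \<and> search_forest E us vs = ([], t # F)} =
      {E. E \<subseteq> pairs (set us' \<union> set [u]) \<and> search_forest E us' [u] = ([t], F)}"
    unfolding us vs search_forest_new_component by simp
  also have "real (card \<dots>) = fact (length us') * vol_const [t] F * 2 ^ (length [t] choose 2)"
    using 2 us us_len by (intro "2.IH") auto
  also have "\<dots> = fact (length us) * vol_const [] (t # F) * 2 ^ (length ([] :: plane_tree list) choose 2)"
    unfolding vol_const.simps(2) us_len[symmetric] us by (simp add: numeral_2_eq_2 del: of_nat_Suc)
  finally show ?case .
next
  case (3 ts st F)
  then obtain v vs' where vs: "vs = v # vs'" "length vs' = length st"
    by (cases vs) auto
  let ?k = "length ts" and ?r = "length us" and ?l = "length st"
  have k: "?k \<le> ?r"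
    using "3.prems"(2,3) length_le_total_nodes[of ts] length_le_total_nodes[of st] by simp
  have "real (card {E. E \<subseteq> pairs (set us \<union> set vs') \<and>
      search_forest E (filter (\<lambda>u. u \<notin> A) us) (rev (filter (\<lambda>u. u \<in> A) us) @ vs') = (ts @ st, F)}) =
      fact (?r - ?k) * vol_const (ts @ st) F * 2 ^ (?k + ?l choose 2)"
    if A: "card (A \<inter> set us) = ?k" for A
  proof -
    have len: "length (filter (\<lambda>u. u \<in> A) us) = ?k"
      using A "3.prems"(1) by (simp add: distinct_length_filter Int_commute)
    moreover have "length (filter (\<lambda>u. u \<in> A) us) + length (filter (\<lambda>u. u \<notin> A) us) = ?r"
      by (rule sum_length_filter_compl)
    ultimately have len': "length (filter (\<lambda>u. u \<notin> A) us) = ?r - ?k"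
      by simp
    have "set (filter (\<lambda>u. u \<notin> A) us) \<union> set (rev (filter (\<lambda>u. u \<in> A) us) @ vs') = set us \<union> set vs'"
      by auto
    moreover have "real (card {E. E \<subseteq> pairs (set (filter (\<lambda>u. u \<notin> A) us) \<union>
        set (rev (filter (\<lambda>u. u \<in> A) us) @ vs')) \<and>
        search_forest E (filter (\<lambda>u. u \<notin> A) us) (rev (filter (\<lambda>u. u \<in> A) us) @ vs') = (ts @ st, F)}) =
        fact (length (filter (\<lambda>u. u \<notin> A) us)) * vol_const (ts @ st) F * 2 ^ (length (ts @ st) choose 2)"
      using "3.prems" vs k len len' by (intro "3.IH") auto
    ultimately show ?thesis
      by (simp add: len')
  qed
  note const = this
  have "real (card {E. E \<subseteq> pairs (set us \<union> set vs) \<and> search_forest E us vs = (PNode ts # st, F)}) =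
      real (card {A. A \<subseteq> set us \<union> set vs' \<and> card (A \<inter> set us) = ?k}) *
        (fact (?r - ?k) * vol_const (ts @ st) F * 2 ^ (?k + ?l choose 2))"
    unfolding vs(1) card_search_forest_step[OF "3.prems"(1)[unfolded vs(1)]] of_nat_sum
    by (subst sum.cong[OF refl const]) simp_all
  also have "card {A. A \<subseteq> set us \<union> set vs' \<and> card (A \<inter> set us) = ?k} = (?r choose ?k) * 2 ^ ?l"
    using "3.prems"(1) vs by (subst card_subsets_Int) (auto simp: distinct_card)
  \<comment> \<open>\<open>(r choose k) * fact (r - k) = fact r / fact k\<close>, and \<open>l + (k
    + l choose 2) = l * k + (k choose 2) + (Suc l choose 2)\<close> splits the exponent into that of
    \<open>vol_const\<close> and that of the stack with the active node.\<close>
  also have "real ((?r choose ?k) * 2 ^ ?l) * (fact (?r - ?k) * vol_const (ts @ st) F * 2 ^ (?k + ?l choose 2)) =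
      fact ?r * vol_const (PNode ts # st) F * 2 ^ (length (PNode ts # st) choose 2)"
    using k by (simp add: binomial_fact Suc_choose_2 choose_2_add power_add field_simps)
  finally show ?case .
qed

text \<open>The search starts with an empty stack and \<open>n + 1\<close> unvisited nodes; the
  division by the number of nodes in \<open>vol_const [] (t # F)\<close> turns
  \<open>fact (n + 1)\<close> into \<open>fact n\<close>.\<close>

lemma card_graphs:
  assumes "t # F \<in> plane_forests (n + 1)"
  shows "real (card {G \<in> labeled_graphs (n + 1). Psi (n + 1) G = t # F}) = fact n * vol_const [t] F"
proof -
  let ?us = "rev [1..<n + 1 + 1]"
  have "set ?us \<union> set [] = {1..n + 1}"
    by auto
  then have "{G \<in> labeled_graphs (n + 1). Psi (n + 1) G = t # F} =
      {E. E \<subseteq> pairs (set ?us \<union> set []) \<and> search_forest E ?us [] = ([], t # F)}"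
    using length_search_forest[of _ ?us "[]"]
    by (auto simp: labeled_graphs_def Psi_search_forest prod_eq_iff simp del: upt_Suc)
  then show ?thesis
    using card_search_forest[of ?us "[]" "[]" "t # F"] assms
    by (simp add: plane_forests_def numeral_2_eq_2 del: upt_Suc)
qed

subsection \<open>The closed formula\<close>

lemma degree_seq_nonempty [simp]: "degree_seq t \<noteq> []"
  by (cases t) simp

lemma length_degree_seq: "length (degree_seq t) = num_nodes t"
proof (induction t)
  case (PNode ts)
  then show ?case
    by (simp add: length_concat o_def cong: map_cong)
qed

lemma sum_list_concat: "sum_list (concat xss) = sum_list (map sum_list xss)"
  for xss :: "nat list list"
  by (induction xss) auto

text \<open>Every node except the root is a child of exactly one node.\<close>

lemma sum_list_degree_seq: "Suc (sum_list (degree_seq t)) = num_nodes t"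
proof (induction t)
  case (PNode ts)
  then have "total_nodes ts = (\<Sum>t\<leftarrow>ts. 1 + sum_list (degree_seq t))"
    by (intro arg_cong[where f = sum_list] map_cong) auto
  then show ?case
    by (simp add: sum_list_Suc sum_list_concat o_def)
qed

lemma last_degree_seq: "last (degree_seq t) = 0"
proof (induction t)
  case (PNode ts)
  then show ?case
    by (cases ts rule: rev_cases) auto
qed

lemma reduced_degree_seq_Cons:
  "reduced_degree_seq (t # F) = butlast (degree_seq t) @ reduced_degree_seq F"
  by (simp add: reduced_degree_seq_def)

lemma length_reduced_degree_seq: "length (reduced_degree_seq F) + length F = total_nodes F"
proof (induction F)
  case (Cons t F)
  then show ?case
    using num_nodes_pos[of t] by (simp add: reduced_degree_seq_Cons length_degree_seq)
qed (simp add: reduced_degree_seq_def)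

lemma sum_reduced_degree_seq: "sum_list (reduced_degree_seq F) + length F = total_nodes F"
proof (induction F)
  case (Cons t F)
  have "sum_list (butlast (degree_seq t)) + last (degree_seq t) = sum_list (degree_seq t)"
    by (metis append_butlast_last_id degree_seq_nonempty sum_list.Nil sum_list.Cons
        sum_list_append add_0_right)
  with Cons show ?case
    using sum_list_degree_seq[of t] by (simp add: reduced_degree_seq_Cons last_degree_seq)
qed (simp add: reduced_degree_seq_def)

text \<open>
  \<open>c\<close> is the number of nodes waiting on the stack below the active node, that is, the cane count
  of its rightmost child.  It does not change when a component with a final degree \<open>0\<close> ends.
\<close>

fun cane_exponent :: "nat list \<Rightarrow> int \<Rightarrow> int" where
  "cane_exponent [] c = 0"
| "cane_exponent (d # ds) c = int d * c + int (d choose 2) + cane_exponent ds (c + int d - 1)"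

text \<open>The height at the \<open>i\<close>-th entry is \<open>c\<close> plus the sum of
  \<open>d_j - 1\<close> over \<open>j < i\<close>. The products \<open>d_i * d_j\<close> and the
  terms \<open>d_i choose 2\<close> combine to \<open>sum_list ds choose 2\<close>; the decrements
  give the weighted sum, whose weights start at \<open>1\<close>, hence
  \<open>c + 1\<close>.\<close>

lemma cane_exponent_closed:
  "cane_exponent ds c = int (sum_list ds choose 2) + (c + 1) * int (sum_list ds) -
     int (\<Sum>i<length ds. Suc i * ds ! i)"
proof (induction ds arbitrary: c)
  case (Cons d ds)
  have "(\<Sum>i<length (d # ds). Suc i * (d # ds) ! i) = d + (\<Sum>i<length ds. Suc (Suc i) * ds ! i)"
    by (simp add: sum.lessThan_Suc_shift del: sum.lessThan_Suc)
  also have "(\<Sum>i<length ds. Suc (Suc i) * ds ! i) =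
      (\<Sum>i<length ds. Suc i * ds ! i) + (\<Sum>i<length ds. ds ! i)"
    by (simp add: sum.distrib)
  also have "(\<Sum>i<length ds. ds ! i) = sum_list ds"
    by (simp add: sum_list_sum_nth lessThan_atLeast0)
  finally show ?case
    using Cons.IH[of "c + int d - 1"] by (simp add: choose_2_add algebra_simps)
qed (simp add: numeral_2_eq_2)

section \<open>Products of the sizes of forest suffixes\<close>

fun suffix_prod :: "plane_forest \<Rightarrow> nat" where
  "suffix_prod [] = 1"
| "suffix_prod (t # F) = total_nodes (t # F) * suffix_prod F"

lemma suffix_prod_alt: "suffix_prod F = (\<Prod>i<length F. total_nodes (drop i F))"
  by (induction F) (auto simp: prod.lessThan_Suc_shift simp del: prod.lessThan_Suc)

lemma total_nodes_drop:
  "k \<le> length F \<Longrightarrow> total_nodes (drop k F) = (\<Sum>l=Suc k..length F. num_nodes (F ! (l - 1)))"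
  by (auto simp: sum_list_sum_nth add.commute
      intro!: sum.reindex_bij_witness[of _ "\<lambda>l. l - Suc k" "\<lambda>i. i + Suc k"])

lemma suffix_prod_components:
  "suffix_prod F = (\<Prod>j=2..Suc (length F). \<Sum>l=j..Suc (length F). num_nodes ((t # F) ! (l - 1)))"
proof -
  have "total_nodes (drop i F) = (\<Sum>l=Suc (Suc i)..Suc (length F). num_nodes ((t # F) ! (l - 1)))"
    if "i < length F" for i
    using that total_nodes_drop[of "Suc i" "t # F"] by simp
  then have "suffix_prod F =
      (\<Prod>i<length F. \<Sum>l=Suc (Suc i)..Suc (length F). num_nodes ((t # F) ! (l - 1)))"
    unfolding suffix_prod_alt by (intro prod.cong) auto
  also have "\<dots> = (\<Prod>j=2..Suc (length F). \<Sum>l=j..Suc (length F). num_nodes ((t # F) ! (l - 1)))"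
    by (rule prod.reindex_bij_witness[of _ "\<lambda>j. j - 2" "\<lambda>i. Suc (Suc i)"])
      (auto simp: numeral_2_eq_2 Suc_diff_Suc)
  finally show ?thesis .
qed

text \<open>The degrees still to be read, in preorder, which is the order of activation.
  \<open>butlast\<close> removes the final \<open>0\<close> of the current component and has no
  effect on an empty stack.\<close>

definition reduced_word :: "plane_tree list \<Rightarrow> plane_forest \<Rightarrow> nat list" where
  "reduced_word st F = butlast (concat (map degree_seq st)) @ reduced_degree_seq F"

text \<open>The height below the active node is \<open>length st - 1\<close>. On natural numbers
  this is \<open>0\<close> for the empty stack too, so the start of a component leaves the exponent
  unchanged.\<close>

lemma vol_const_reduced_word:
  "vol_const st F = 2 powi (cane_exponent (reduced_word st F) (int (length st - 1))) /
     (\<Prod>d\<leftarrow>reduced_word st F. fact d) / suffix_prod F"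
proof (induction st F rule: vol_const.induct)
  case 1
  then show ?case
    by (simp add: reduced_word_def reduced_degree_seq_def)
next
  case (2 t F)
  have "reduced_word [] (t # F) = reduced_word [t] F"
    by (simp add: reduced_word_def reduced_degree_seq_Cons)
  with 2 show ?case
    by (simp add: mult.commute)
next
  case (3 ts st F)
  show ?case
  proof (cases "ts @ st = []")
    \<comment> \<open>Only the last leaf of the component is left; its degree \<open>0\<close> is
      the deleted one.\<close>
    case True
    with 3 show ?thesis
      by (simp add: reduced_word_def numeral_2_eq_2)
  next
    case False
    then have "concat (map degree_seq (ts @ st)) \<noteq> []"
      by (cases "ts @ st") auto
    then have "reduced_word (PNode ts # st) F = length ts # reduced_word (ts @ st) F"
      by (auto simp: reduced_word_def)
    moreover have "int (length (ts @ st) - 1) = int (length st) + int (length ts) - 1"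
      using False by (cases ts; cases st) auto
    moreover have "2 powi (int (length ts) * int (length st) + int (length ts choose 2) + i) =
        (2 ^ (length st * length ts + (length ts choose 2)) :: real) * 2 powi i" for i
      by (simp add: power_int_add power_add mult.commute[of "int (length ts)"] flip: of_nat_mult)
    ultimately show ?thesis
      using 3 by simp
  qed
qed

lemma graph_count_formula:
  assumes "t # F \<in> plane_forests (n + 1)"
  defines "m \<equiv> length (t # F)"
  shows "fact n * vol_const [t] F =
    multinomial_coeff n (reduced_degree_seq (t # F)) /
      (\<Prod>j=2..m. real (\<Sum>l=j..m. num_nodes ((t # F) ! (l - 1)))) *
    2 powi (int ((n + 2 - m) choose 2) -
      int (\<Sum>i=1..n+1-m. i * reduced_degree_seq (t # F) ! (i - 1)))"
proof -
  let ?ds = "reduced_degree_seq (t # F)"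
  have n: "total_nodes (t # F) = n + 1"
    using assms by (simp add: plane_forests_def)
  have len: "length ?ds = n + 1 - m" and sum: "sum_list ?ds = n + 1 - m" and m: "m \<le> n + 1"
    using length_reduced_degree_seq[of "t # F"] sum_reduced_degree_seq[of "t # F"] n
    by (simp_all add: m_def)
  have "(\<Sum>i<length ?ds. Suc i * ?ds ! i) = (\<Sum>i=1..n+1-m. i * ?ds ! (i - 1))"
    unfolding len by (rule sum.reindex_bij_witness[of _ "\<lambda>i. i - 1" Suc]) auto
  moreover have "n + 2 - m = Suc (n + 1 - m)"
    using m by simp
  \<comment> \<open>The sum \<open>S\<close> of the reduced sequence is \<open>n + 1 - m\<close>;
    with \<open>c = 0\<close>, the identity \<open>(S choose 2) + S = Suc S choose 2\<close> gives
    the binomial coefficient.\<close>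
  ultimately have "cane_exponent ?ds 0 =
      int ((n + 2 - m) choose 2) - int (\<Sum>i=1..n+1-m. i * ?ds ! (i - 1))"
    by (simp only: cane_exponent_closed sum Suc_choose_2 of_nat_add add_0 mult_1_left)
  moreover have "reduced_word [t] F = ?ds"
    by (simp add: reduced_word_def reduced_degree_seq_Cons)
  moreover have "real (suffix_prod F) = (\<Prod>j=2..m. real (\<Sum>l=j..m. num_nodes ((t # F) ! (l - 1))))"
    unfolding suffix_prod_components[of F t] m_def by simp
  ultimately show ?thesis
    unfolding vol_const_reduced_word[of "[t]" F] multinomial_coeff_def by simp
qed

text \<open>Every forest comes from a positive number of graphs, so it lies in the image of a finite
  set under \<open>Psi\<close>.\<close>

lemma finite_plane_forests: "finite (plane_forests (n + 1))"
proof (rule finite_subset)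
  show "plane_forests (n + 1) \<subseteq> Psi (n + 1) ` labeled_graphs (n + 1)"
  proof
    fix F
    assume F: "F \<in> plane_forests (n + 1)"
    then obtain t F' where "F = t # F'"
      using plane_forests_nonempty by blast
    with card_graphs[of t F' n] F vol_const_pos[of "[t]" F']
    have "0 < card {G \<in> labeled_graphs (n + 1). Psi (n + 1) G = F}"
      by (metis fact_gt_zero mult_pos_pos of_nat_0_less_iff)
    then show "F \<in> Psi (n + 1) ` labeled_graphs (n + 1)"
      by (auto simp: card_gt_0_iff)
  qed
  show "finite (Psi (n + 1) ` labeled_graphs (n + 1))"
    by (simp add: labeled_graphs_def)
qed

theorem theorem5p3:
  fixes n :: nat and e :: "nat \<Rightarrow> 'n::finite"
  assumes n: "n = CARD('n)"
    and e: "bij_betw e {1..n} (UNIV :: 'n set)"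
  shows "(\<forall>F\<in>plane_forests (n + 1).
      let m = length F;
          a = (\<lambda>j. num_nodes (F ! (j - 1)));
          d = (\<lambda>i. reduced_degree_seq F ! (i - 1));
          graphs = {G \<in> labeled_graphs (n + 1). Psi (n + 1) G = F}
      in polytope (D_forest e F) \<and> bounded (D_forest e F) \<and>
         fact n * measure lebesgue (D_forest e F) = real (card graphs) \<and>
         real (card graphs) =
           multinomial_coeff n (reduced_degree_seq F) / (\<Prod>j=2..m. real (\<Sum>l=j..m. a l)) *
           2 powi (int ((n + 2 - m) choose 2) - int (\<Sum>i=1..n+1-m. i * d i))) \<and>
    subdivision (D_forest e ` plane_forests (n + 1)) (Gayley e) \<and>
    inj_on (D_forest e) (plane_forests (n + 1)) \<and>
    fact n * measure lebesgue (Gayley e) = (2::real) ^ ((n + 1) choose 2)"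
proof -
  note e = e[unfolded n]
  let ?P = "plane_forests (n + 1)"
  have poly: "polytope (D_forest e F)" if "F \<in> ?P" for F
    using plane_forests_nonempty[OF that] polytope_D_forest[OF e] by auto
  have bounded: "bounded (D_forest e F)" if "F \<in> ?P" for F
    using polytope_imp_bounded[OF poly[OF that]] .
  \<comment> \<open>Positive volume serves twice: for full dimension and for injectivity.\<close>
  have not_negl: "\<not> negligible (D_forest e F)" if F: "F \<in> ?P" for F
  proof -
    obtain t F' where "F = t # F'"
      using plane_forests_nonempty[OF F] by blast
    then have "0 < measure lebesgue (D_forest e F)"
      using measure_D_forest[OF e, of t F'] vol_const_pos[of "[t]" F'] that n by simp
    then show ?thesis
      using negligible_imp_measure0 by force
  qed
  have negl: "negligible (D_forest e F \<inter> D_forest e F')" if "F \<in> ?P" "F' \<in> ?P" "F \<noteq> F'" for F F'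
    using plane_forests_nonempty[OF that(1)] plane_forests_nonempty[OF that(2)] that(3)
      negligible_D_forest_Int[OF e] by auto
  have "aff_dim (D_forest e F) = int DIM(real ^ 'n)" if "F \<in> ?P" for F
    using poly[OF that] not_negl[OF that]
    by (intro aff_dim_nonempty_interior) (simp add: negligible_convex_interior polytope_imp_convex)
  moreover have "interior (D_forest e F) \<inter> interior (D_forest e F') = {}"
    if "F \<in> ?P" "F' \<in> ?P" "F \<noteq> F'" for F F'
  \<comment> \<open>A nonempty open set is not negligible, whereas two different cells meet in a
    negligible set.\<close>
  proof (rule ccontr)
    assume "interior (D_forest e F) \<inter> interior (D_forest e F') \<noteq> {}"
    then have "\<not> negligible (interior (D_forest e F) \<inter> interior (D_forest e F'))"
      by (intro open_not_negligible) auto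
    moreover have "interior (D_forest e F) \<inter> interior (D_forest e F') \<subseteq> D_forest e F \<inter> D_forest e F'"
      using interior_subset by blast
    ultimately show False
      using negl[OF that] negligible_subset by blast
  qed
  ultimately have "subdivision (D_forest e ` ?P) (Gayley e)"
    unfolding subdivision_def
    using polytope_Gayley[OF e] finite_plane_forests poly Union_D_forest[OF e] n by auto
  \<comment> \<open>A polytope shared by two forests would be its own intersection, hence
    negligible.\<close>
  moreover have "inj_on (D_forest e) ?P"
    using negl not_negl by (intro inj_onI) (metis Int_absorb)
  moreover have "fact n * measure lebesgue (Gayley e) = (2::real) ^ ((n + 1) choose 2)"
    using measure_Gayley[OF e] n by simp
  moreover have "fact n * measure lebesgue (D_forest e F) =
        real (card {G \<in> labeled_graphs (n + 1). Psi (n + 1) G = F}) \<and>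
      real (card {G \<in> labeled_graphs (n + 1). Psi (n + 1) G = F}) =
        multinomial_coeff n (reduced_degree_seq F) /
          (\<Prod>j=2..length F. real (\<Sum>l=j..length F. num_nodes (F ! (l - 1)))) *
        2 powi (int ((n + 2 - length F) choose 2) -
          int (\<Sum>i=1..n+1-length F. i * reduced_degree_seq F ! (i - 1)))"
    if F_in: "F \<in> ?P" for F
  proof -
    obtain t F' where F: "F = t # F'"
      using plane_forests_nonempty[OF F_in] by blast
    show ?thesis
      using measure_D_forest[OF e, of t F'] card_graphs[of t F' n] graph_count_formula[of t F' n] that n
      unfolding F by simp
  qed
  ultimately show ?thesis
    using poly bounded by (simp add: Let_def)
qed

end
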